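(* Let $X,Y$ be continuous random variables on a common probability space for which $Y$ is completely dependent on $X$ or $X$ is completely dependent on $Y$. Then $\|C_{X,Y}\|_*=1$.
   Context: A copula is a function $C\colon[0,1]^2\to[0,1]$ with $C(u,0)=0=C(0,v)$, $C(u,1)=u$, $C(1,v)=v$ and $C(u,v)-C(u,y)-C(x,v)+C(x,y)\ge 0$ whenever $x\le u$, $y\le v$; $\mathfrak{C}$ is the set of copulas. For continuous random variables $X,Y$ (continuous distribution functions $F,G$) with joint distribution function $H$, $C_{X,Y}$ is the unique copula with $H(x,y)=C_{X,Y}(F(x),G(y))$. $Y$ is completely dependent on $X$ if $Y=h(X)$ almost surely for some Borel measurable $h$. The $*$-product is $(A*B)(x,y)=\int_0^1\partial_2A(x,t)\,\partial_1B(t,y)\,dt$ and the Sobolev norm is $\|A\|^2=\int_0^1\int_0^1\big((\partial_1A)^2+(\partial_2A)^2\big)\,dx\,dy$. With $M(x,y)=\min(x,y)$, $\operatorname{Inv}\mathfrak{C}$ is the set of invertible copulas, i.e. copulas $U$ for which there is a copula $D$ with $U*D=M=D*U$; equivalently (known), copulas with $\|U\|=1$. The $*$-norm is $\|A\|_*=\sup_{U,V\in\operatorname{Inv}\mathfrak{C}}\|U*A*V\|$. *)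

theory Defs
  imports "HOL-Probability.Probability"
begin

abbreviation unit_square :: "(real \<times> real) set" where
  "unit_square \<equiv> {0..1} \<times> {0..1}"

(* Functions on the unit square are extensional (undefined outside), so that equality of
   copulas in HOL is equality on the square and copula_of below is a genuine definite
   description. *)

definition copulas :: "(real \<times> real \<Rightarrow> real) set" where
  "copulas = {C \<in> unit_square \<rightarrow>\<^sub>E {0..1}.
     (\<forall>u\<in>{0..1}. C (u, 0) = 0 \<and> C (0, u) = 0 \<and> C (u, 1) = u \<and> C (1, u) = u) \<and>
     (\<forall>x\<in>{0..1}. \<forall>u\<in>{0..1}. \<forall>y\<in>{0..1}. \<forall>v\<in>{0..1}. x \<le> u \<longrightarrow> y \<le> v \<longrightarrow>
        C (u, v) - C (u, y) - C (x, v) + C (x, y) \<ge> 0)}"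

(* Copulas are 1-Lipschitz in each variable, so the partial derivatives exist almost
   everywhere on the square.  Where one does not exist, deriv returns a fixed constant that
   does not depend on the point; this, and what happens on the boundary of the square,
   affects the integrals below only on null sets. *)

definition partial1 :: "(real \<times> real \<Rightarrow> real) \<Rightarrow> real \<Rightarrow> real \<Rightarrow> real" where
  "partial1 A x y = deriv (\<lambda>s. A (s, y)) x"

definition partial2 :: "(real \<times> real \<Rightarrow> real) \<Rightarrow> real \<Rightarrow> real \<Rightarrow> real" where
  "partial2 A x y = deriv (\<lambda>t. A (x, t)) y"

definition star_prod ::
    "(real \<times> real \<Rightarrow> real) \<Rightarrow> (real \<times> real \<Rightarrow> real) \<Rightarrow> (real \<times> real \<Rightarrow> real)" where
  "star_prod A B =
     (\<lambda>(x, y)\<in>unit_square. LBINT t:{0..1}. partial2 A x t * partial1 B t y)"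

definition sobolev_norm :: "(real \<times> real \<Rightarrow> real) \<Rightarrow> real" where
  "sobolev_norm A =
     sqrt (LBINT y:{0..1}. LBINT x:{0..1}. (partial1 A x y)\<^sup>2 + (partial2 A x y)\<^sup>2)"

definition M_copula :: "real \<times> real \<Rightarrow> real" where
  "M_copula = (\<lambda>(x, y)\<in>unit_square. min x y)"

definition inv_copulas :: "(real \<times> real \<Rightarrow> real) set" where
  "inv_copulas =
     {U \<in> copulas. \<exists>D\<in>copulas. star_prod U D = M_copula \<and> star_prod D U = M_copula}"

(* The star product of copulas is associative, so the bracketing is immaterial; the
   supremum is over a nonempty set of reals bounded by 1 when A is a copula. *)
definition star_norm :: "(real \<times> real \<Rightarrow> real) \<Rightarrow> real" where
  "star_norm A =
     (SUP (U, V)\<in>inv_copulas \<times> inv_copulas. sobolev_norm (star_prod (star_prod U A) V))"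

definition continuous_rv :: "'a measure \<Rightarrow> ('a \<Rightarrow> real) \<Rightarrow> bool" where
  "continuous_rv P X \<longleftrightarrow>
     X \<in> borel_measurable P \<and> continuous_on UNIV (cdf (distr P borel X))"

definition copula_of ::
    "'a measure \<Rightarrow> ('a \<Rightarrow> real) \<Rightarrow> ('a \<Rightarrow> real) \<Rightarrow> (real \<times> real \<Rightarrow> real)" where
  "copula_of P X Y = (THE C. C \<in> copulas \<and>
     (\<forall>x y. measure P {\<omega> \<in> space P. X \<omega> \<le> x \<and> Y \<omega> \<le> y} =
       C (cdf (distr P borel X) x, cdf (distr P borel Y) y)))"

definition completely_dependent :: "'a measure \<Rightarrow> ('a \<Rightarrow> real) \<Rightarrow> ('a \<Rightarrow> real) \<Rightarrow> bool" where
  "completely_dependent P Y X \<longleftrightarrow>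
     (\<exists>h\<in>borel_measurable borel. AE \<omega> in P. Y \<omega> = h (X \<omega>))"

end

theory Submission
  imports Defs
begin

text \<open>Replacing $X$ and $Y$ by $F(X)$ and $G(Y)$ turns the copula $C_{X,Y}$ into the joint distribution
function \<open>joint_df\<close> of two uniform random variables $U$ and $V$, and complete dependence of one
variable on the other carries over from $X$ and $Y$ to $U$ and $V$ (\<open>copula_of_eq_joint_df\<close>,
\<open>completely_dependent_cdf_transform\<close>). The two halves of the theorem are then of a different
nature.

Upper bound. The first partial derivative of a copula lies between $0$ and $1$ almost everywhere,
so its square is dominated by the derivative itself, whose integral over $x$ is $y$ by the
fundamental theorem of calculus; hence either partial derivative contributes at most $1/2$ to the squared Sobolev norm
(\<open>sobolev_norm_le_1\<close>). Since the star product of copulas is a copula (\<open>star_prod_copula\<close>), no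
product $U * A * V$ has norm above $1$. All of this rests on the almost everywhere
differentiability of monotone Lipschitz functions: such a function is the integral of a density
(\<open>lipschitz_cdf_density\<close>), and the Vitali covering theorem shows that an indefinite integral has
the integrand as its derivative almost everywhere (\<open>lebesgue_differentiation\<close>).

Lower bound. Suppose that $V$ is almost surely a function of $U$. Sort the unit interval by the key
$K = \<lfloor>nV\<rfloor> + U$ and let $Z$ be the rank $F_K(K)$. The integer part of the key forces
$|Z - V| \<le> 1/n$, while its fractional part recovers $U$, so that $Z$ and $U$ determine each other
and the copula of $(Z, U)$ is invertible, its inverse being the copula of $(U, Z)$
(\<open>rearrangement_near_diagonal\<close>, \<open>joint_df_invertible\<close>). When $Z$ and $V$ are both functions
of $U$, the derivatives $D_2 C_{Z,U}$ and $D_1 C_{U,V}$ are indicators of events determined by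
$U$, so their product integrates to the probability of the intersection:
$C_{Z,U} * C_{U,V} = C_{Z,V}$ (\<open>star_prod_joint_df\<close>). Finally, $C_{Z,V}(x,y) = min(x,y)$ as soon
as $|x-y| > 1/n$, so that one of its partial derivatives equals $1$ there, and its norm is at
least $1 - 2/n$ (\<open>sobolev_norm_near_diagonal\<close>). If instead $U$ is a function of $V$, the same
rearrangement is applied to the second variable and multiplied from the right.\<close>

section \<open>Lebesgue differentiation on the real line\<close>

text \<open>A finite measure has density zero at almost every point of a set it does not charge. At the
exceptional points for a given $c$ there are arbitrarily small intervals of radius $h$ and
$M$-measure above $c h$. A disjoint Vitali family of them inside an open set of small $M$-measure
covers these points up to a null set, and its Lebesgue measure is at most $2/c$ times its
$M$-measure.\<close>

lemma AE_measure_cball_small_on_null_set: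
  fixes M :: "real measure"
  assumes "finite_measure M" and sets: "sets M = sets borel"
    and N: "N \<in> sets borel" "emeasure M N = 0"
  shows "AE x in lborel. x \<in> N \<longrightarrow>
    (\<forall>c>0. \<exists>d>0. \<forall>h. 0 < h \<and> h < d \<longrightarrow> measure M (cball x h) \<le> c * h)"
proof -
  interpret finite_measure M by fact
  define E where "E c = {x \<in> N. \<forall>d>0. \<exists>h. 0 < h \<and> h < d \<and> c * h < measure M (cball x h)}" for c
  have neg: "negligible (E c)" if "c > 0" for c
    unfolding negligible_outer_le
  proof (intro allI impI)
    fix e :: real assume "e > 0"
    \<comment> \<open>The bound \<open>e * c / 2\<close> is chosen so that the factor \<open>2 / c\<close> picked up by the covering gives \<open>e\<close>.\<close>
    have "(INF U \<in> {U. N \<subseteq> U \<and> open U}. emeasure M U) < ennreal (e * c / 2)"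
      using outer_regular[OF sets _ N(1)] N(2) \<open>e > 0\<close> \<open>c > 0\<close>
      by (simp add: emeasure_eq_measure)
    then obtain G where G: "N \<subseteq> G" "open G" "emeasure M G < ennreal (e * c / 2)"
      by (auto simp: INF_less_iff)
    define K where "K = {(x, h). x \<in> E c \<and> 0 < h \<and> cball x h \<subseteq> G \<and> c * h < measure M (cball x h)}"
    have fine: "\<exists>i. i \<in> K \<and> x \<in> cball (fst i) (snd i) \<and> snd i < d" if "x \<in> E c" "0 < d" for x d
    proof -
      have "x \<in> G" using that G(1) by (auto simp: E_def)
      then obtain d' where d': "d' > 0" "cball x d' \<subseteq> G"
        using G(2) by (meson open_contains_cball)
      have "\<forall>d>0. \<exists>h. 0 < h \<and> h < d \<and> c * h < measure M (cball x h)"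
        using \<open>x \<in> E c\<close> unfolding E_def by blast
      moreover have "0 < min d d'" using \<open>0 < d\<close> d'(1) by simp
      ultimately obtain h where h: "0 < h" "h < min d d'" "c * h < measure M (cball x h)"
        by blast
      have "cball x h \<subseteq> G"
        using d'(2) h(2) subset_cball[of h d' x] by auto
      then have "(x, h) \<in> K" using \<open>x \<in> E c\<close> h by (simp add: K_def)
      then show ?thesis using h by (intro exI[of _ "(x, h)"]) simp
    qed
    have pos: "0 < snd i" if "i \<in> K" for i using that by (auto simp: K_def)
    obtain C where C: "countable C" "C \<subseteq> K"
      "pairwise (\<lambda>i j. disjnt (cball (fst i) (snd i)) (cball (fst j) (snd j))) C"
      "negligible (E c - (\<Union>i\<in>C. cball (fst i) (snd i)))"
      by (rule Vitali_covering_theorem_cballs[of K snd "E c" fst, OF pos fine]) (assumption | rule that)+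
    define B where "B = (\<Union>i\<in>C. cball (fst i) (snd i))"
    have B: "B \<in> sets borel" unfolding B_def by (intro sets.countable_UN' C) auto
    have disj: "disjoint_family_on (\<lambda>i. cball (fst i) (snd i)) C"
      using C(3) by (auto simp: disjoint_family_on_def pairwise_def disjnt_def)
    have "emeasure lborel B = (\<integral>\<^sup>+i. emeasure lborel (cball (fst i) (snd i)) \<partial>count_space C)"
      unfolding B_def by (intro emeasure_UN_countable C disj) auto
    also have "\<dots> \<le> (\<integral>\<^sup>+i. ennreal (2 / c) * emeasure M (cball (fst i) (snd i)) \<partial>count_space C)"
    proof (intro nn_integral_mono)
      fix i assume "i \<in> space (count_space C)"
      then have i: "0 < snd i" "c * snd i < measure M (cball (fst i) (snd i))"
        using C(2) by (auto simp: K_def)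
      have "emeasure lborel (cball (fst i) (snd i)) = ennreal (2 * snd i)"
        using i(1) by (simp add: cball_eq_atLeastAtMost)
      also have "\<dots> \<le> ennreal (2 / c * measure M (cball (fst i) (snd i)))"
        using i \<open>c > 0\<close> by (intro ennreal_leI) (simp add: field_simps)
      finally show "emeasure lborel (cball (fst i) (snd i))
          \<le> ennreal (2 / c) * emeasure M (cball (fst i) (snd i))"
        using \<open>c > 0\<close> unfolding emeasure_eq_measure by (subst ennreal_mult[symmetric]) auto
    qed
    also have "\<dots> = ennreal (2 / c) * (\<integral>\<^sup>+i. emeasure M (cball (fst i) (snd i)) \<partial>count_space C)"
      by (intro nn_integral_cmult) auto
    also have "(\<integral>\<^sup>+i. emeasure M (cball (fst i) (snd i)) \<partial>count_space C) = emeasure M B"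
      unfolding B_def by (intro emeasure_UN_countable[symmetric] C disj) (auto simp: sets)
    also have "emeasure M B \<le> emeasure M G"
    proof (intro emeasure_mono)
      show "B \<subseteq> G" unfolding B_def
      proof (intro UN_least)
        fix i assume "i \<in> C"
        then show "cball (fst i) (snd i) \<subseteq> G" using C(2) by (cases i) (auto simp: K_def)
      qed
    qed (use G(2) sets in auto)
    also have "\<dots> \<le> ennreal (e * c / 2)" using G(3) by simp
    also have "ennreal (2 / c) * ennreal (e * c / 2) = ennreal e"
      using \<open>c > 0\<close> \<open>e > 0\<close> by (simp add: ennreal_mult[symmetric])
    finally have Be: "emeasure lborel B \<le> ennreal e"
      by (simp add: mult_left_mono)
    have "negligible (E c - B)" using C(4) by (simp add: B_def)
    then have nul: "E c - B \<in> null_sets lebesgue" by (simp add: negligible_iff_null_sets)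
    have em: "emeasure lebesgue ((E c - B) \<union> B) = emeasure lborel B"
      using nul B by (subst Un_commute, subst emeasure_Un_null_set) auto
    have "(E c - B) \<union> B \<in> sets lebesgue"
      using nul B by (intro sets.Un) auto
    then have "(E c - B) \<union> B \<in> lmeasurable"
      using em Be by (intro fmeasurableI) (auto intro: le_less_trans)
    moreover have "measure lebesgue ((E c - B) \<union> B) \<le> e"
      unfolding measure_def em using Be \<open>e > 0\<close> by (metis enn2real_leI less_imp_le)
    ultimately show "\<exists>T. E c \<subseteq> T \<and> T \<in> lmeasurable \<and> measure lebesgue T \<le> e"
      by (intro exI[of _ "(E c - B) \<union> B"]) auto
  qed
  have "AE x in lborel. x \<notin> E (1 / real (Suc n))" for n
    using neg[of "1 / real (Suc n)"]
    by (metis AE_completion_iff AE_not_in negligible_iff_null_sets of_nat_0_less_iff zero_less_Suc zero_less_divide_1_iff)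
  then have "AE x in lborel. \<forall>n. x \<notin> E (1 / real (Suc n))"
    by (simp add: AE_all_countable)
  then show ?thesis
  proof (rule AE_mp, intro AE_I2 impI allI)
    fix x c :: real
    assume x: "\<forall>n. x \<notin> E (1 / real (Suc n))" "x \<in> N" and "0 < c"
    obtain n where n: "1 / real (Suc n) < c" using \<open>0 < c\<close> by (metis nat_approx_posE)
    obtain d where d: "d > 0" "\<And>h. 0 < h \<Longrightarrow> h < d \<Longrightarrow> measure M (cball x h) \<le> 1 / real (Suc n) * h"
      using x(2) x(1)[rule_format, of n] unfolding E_def
      by (simp only: mem_Collect_eq simp_thms not_all not_ex not_imp not_less de_Morgan_conj)
        (meson not_less)
    show "\<exists>d>0. \<forall>h. 0 < h \<and> h < d \<longrightarrow> measure M (cball x h) \<le> c * h"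
    proof (intro exI[of _ d] conjI allI impI d)
      fix h assume h: "0 < h \<and> h < d"
      then have "1 / real (Suc n) * h \<le> c * h" using n by (intro mult_right_mono) auto
      then show "measure M (cball x h) \<le> c * h" using d(2)[of h] h by linarith
    qed
  qed
qed

text \<open>The excess of $g$ over a rational level $r$ defines a measure that vanishes on $\{g \<le> r\}$, so at
almost every point of that set the averages of the excess tend to zero. Applied to rational levels
just above $g(x)$, this bounds the averages of $g$ near $x$ from above; the bound from below comes
from $-g$. Intervals merely containing $x$ are allowed, as two-sided derivatives require.\<close>

lemma AE_upper_average:
  fixes g :: "real \<Rightarrow> real"
  assumes g: "integrable lborel g"
  shows "AE x in lborel. \<forall>e>0. \<exists>d>0. \<forall>a b. a \<le> x \<and> x \<le> b \<and> 0 < b - a \<and> b - a < d \<longrightarrow>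
    (LBINT t:{a..b}. g t) \<le> (g x + e) * (b - a)"
proof -
  have [measurable]: "g \<in> borel_measurable borel" using borel_measurable_integrable[OF g] by simp
  \<comment> \<open>The cut-off to bounded intervals keeps the excess integrable at negative levels \<open>r\<close>.\<close>
  define k where "k r m t = max 0 (g t - r) * indicator {- real m<..<real m} t" for r m t
  have [measurable]: "k r m \<in> borel_measurable borel" for r m unfolding k_def by measurable
  have k0: "0 \<le> k r m t" for r m t by (simp add: k_def)
  have ki: "integrable lborel (k r m)" for r m
  proof (rule Bochner_Integration.integrable_bound)
    have "integrable lborel (indicator {- real m<..<real m} :: real \<Rightarrow> real)"
      by (simp add: integrable_indicator_iff emeasure_lborel_Icc_eq)
    then show "integrable lborel (\<lambda>t. \<bar>g t\<bar> + \<bar>r\<bar> * indicator {- real m<..<real m} t)"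
      using g by auto
    show "AE x in lborel. norm (k r m x) \<le> norm (\<bar>g x\<bar> + \<bar>r\<bar> * indicator {- real m<..<real m} x)"
      by (intro AE_I2) (auto simp: k_def indicator_def)
  qed auto
  define M where "M r m = density lborel (\<lambda>t. ennreal (k r m t))" for r m
  have sM: "sets (M r m) = sets borel" for r m by (simp add: M_def)
  have fM: "finite_measure (M r m)" for r m
  proof (rule finite_measureI)
    have "emeasure (M r m) (space (M r m)) = (\<integral>\<^sup>+t. ennreal (k r m t) \<partial>lborel)"
      by (simp add: M_def emeasure_density)
    also have "\<dots> = ennreal (LINT t|lborel. k r m t)"
      by (intro nn_integral_eq_integral ki) (simp add: k0)
    finally show "emeasure (M r m) (space (M r m)) \<noteq> \<infinity>" by simp
  qed
  have mM: "measure (M r m) S = (LBINT t:S. k r m t)" if "S \<in> sets borel" for r m S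
  proof -
    have "emeasure (M r m) S = (\<integral>\<^sup>+t. ennreal (indicator S t * k r m t) \<partial>lborel)"
      using that unfolding M_def
      by (subst emeasure_density) (auto intro!: nn_integral_cong split: split_indicator)
    also have "\<dots> = ennreal (LBINT t:S. k r m t)"
      unfolding set_lebesgue_integral_def real_scaleR_def using that
      by (intro nn_integral_eq_integral integrable_real_mult_indicator[where f="k r m", simplified mult.commute] ki) (auto simp: k0)
    finally show ?thesis
      by (simp add: measure_def set_lebesgue_integral_def k0)
  qed
  have N0: "emeasure (M r m) {t. g t \<le> r} = 0" for r m
    unfolding M_def by (subst emeasure_density) (auto simp: k_def indicator_def nn_integral_0_iff_AE)
  have "AE x in lborel. \<forall>r\<in>\<rat>. \<forall>m. x \<in> {t. g t \<le> r} \<longrightarrow>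
    (\<forall>c>0. \<exists>d>0. \<forall>h. 0 < h \<and> h < d \<longrightarrow> measure (M r m) (cball x h) \<le> c * h)"
  proof (subst AE_ball_countable[OF countable_rat], intro ballI)
    fix r :: real
    have "AE x in lborel. x \<in> {t. g t \<le> r} \<longrightarrow>
      (\<forall>c>0. \<exists>d>0. \<forall>h. 0 < h \<and> h < d \<longrightarrow> measure (M r m) (cball x h) \<le> c * h)" for m
      by (rule AE_measure_cball_small_on_null_set[OF fM sM _ N0]) measurable
    then show "AE x in lborel. \<forall>m. x \<in> {t. g t \<le> r} \<longrightarrow>
      (\<forall>c>0. \<exists>d>0. \<forall>h. 0 < h \<and> h < d \<longrightarrow> measure (M r m) (cball x h) \<le> c * h)"
      by (subst AE_all_countable) blast
  qed
  then show ?thesis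
  proof (rule AE_mp, intro AE_I2 impI allI)
    fix x e :: real
    assume x: "\<forall>r\<in>\<rat>. \<forall>m. x \<in> {t. g t \<le> r} \<longrightarrow>
      (\<forall>c>0. \<exists>d>0. \<forall>h. 0 < h \<and> h < d \<longrightarrow> measure (M r m) (cball x h) \<le> c * h)" and "0 < e"
    obtain r where r: "r \<in> \<rat>" "g x < r" "r < g x + e / 2"
      using Rats_dense_in_real[of "g x" "g x + e / 2"] \<open>0 < e\<close> by auto
    obtain m :: nat where m: "\<bar>x\<bar> + 1 < real m" using reals_Archimedean2 by blast
    obtain d where d: "d > 0" "\<And>h. 0 < h \<Longrightarrow> h < d \<Longrightarrow> measure (M r m) (cball x h) \<le> (e / 2) * h"
      using bspec[OF x r(1), THEN spec[of _ m]] r(2) \<open>0 < e\<close>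
      by (smt (verit) half_gt_zero mem_Collect_eq)
    show "\<exists>d>0. \<forall>a b. a \<le> x \<and> x \<le> b \<and> 0 < b - a \<and> b - a < d \<longrightarrow>
        (LBINT t:{a..b}. g t) \<le> (g x + e) * (b - a)"
    proof (intro exI[of _ "min d 1"] conjI allI impI)
      show "0 < min d 1" using d by simp
      fix a b :: real assume ab: "a \<le> x \<and> x \<le> b \<and> 0 < b - a \<and> b - a < min d 1"
      have si: "set_integrable lborel S (k r m)" if "S \<in> sets borel" for S
        using ki that unfolding set_integrable_def
        by (intro integrable_mult_indicator) auto
      have gi: "set_integrable lborel {a..b} g"
        using g unfolding set_integrable_def by (intro integrable_mult_indicator) auto
      have ri: "set_integrable lborel {a..b} (\<lambda>_. r)"
        using ab by (simp add: set_integrable_def)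
      have "(LBINT t:{a..b}. g t) - r * (b - a) = (LBINT t:{a..b}. g t) - (LBINT t:{a..b}. r)"
        using ab by (simp add: set_integral_const)
      also have "\<dots> = (LBINT t:{a..b}. g t - r)"
        by (intro set_integral_diff(2)[symmetric] gi ri)
      also have "\<dots> \<le> (LBINT t:{a..b}. k r m t)"
        by (intro set_integral_mono set_integral_diff gi ri si)
          (use ab m in \<open>auto simp: k_def indicator_def\<close>)
      also have "\<dots> \<le> (LBINT t:cball x (b - a). k r m t)"
        unfolding set_lebesgue_integral_def
        by (intro integral_mono si[unfolded set_integrable_def])
          (use ab k0 in \<open>auto simp: cball_eq_atLeastAtMost indicator_def\<close>)
      also have "\<dots> \<le> (e / 2) * (b - a)" using d(2)[of "b - a"] ab by (simp add: mM)
      finally have "(LBINT t:{a..b}. g t) \<le> (r + e / 2) * (b - a)" by (simp only: ring_distribs)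
      also have "\<dots> \<le> (g x + e) * (b - a)" using r ab by (intro mult_right_mono) auto
      finally show "(LBINT t:{a..b}. g t) \<le> (g x + e) * (b - a)" .
    qed
  qed
qed

theorem lebesgue_differentiation:
  fixes F g :: "real \<Rightarrow> real"
  assumes g: "integrable lborel g"
    and F: "\<And>a b. a \<le> b \<Longrightarrow> F b - F a = (LBINT t:{a..b}. g t)"
  shows "AE x in lborel. (F has_real_derivative g x) (at x)"
proof -
  have "AE x in lborel. \<forall>e>0. \<exists>d>0. \<forall>a b. a \<le> x \<and> x \<le> b \<and> 0 < b - a \<and> b - a < d \<longrightarrow>
    (LBINT t:{a..b}. - g t) \<le> (- g x + e) * (b - a)"
    using g by (intro AE_upper_average) auto
  with AE_upper_average[OF g] show ?thesis
  proof eventually_elim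
    case (elim x)
    have "\<exists>s>0. \<forall>y. 0 < \<bar>y - x\<bar> \<and> \<bar>y - x\<bar> < s \<longrightarrow> \<bar>(F y - F x) / (y - x) - g x\<bar> < e"
      if "e > 0" for e
    proof -
      obtain d1 where d1: "d1 > 0" "\<And>a b. a \<le> x \<Longrightarrow> x \<le> b \<Longrightarrow> 0 < b - a \<Longrightarrow> b - a < d1 \<Longrightarrow>
          (LBINT t:{a..b}. g t) \<le> (g x + e / 2) * (b - a)"
        using elim(1)[rule_format, of "e / 2"] \<open>e > 0\<close> by auto
      obtain d2 where d2: "d2 > 0" "\<And>a b. a \<le> x \<Longrightarrow> x \<le> b \<Longrightarrow> 0 < b - a \<Longrightarrow> b - a < d2 \<Longrightarrow>
          (LBINT t:{a..b}. - g t) \<le> (- g x + e / 2) * (b - a)"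
        using elim(2)[rule_format, of "e / 2"] \<open>e > 0\<close> by auto
      show ?thesis
      proof (intro exI[of _ "min d1 d2"] conjI allI impI)
        show "0 < min d1 d2" using d1 d2 by simp
        fix y assume y: "0 < \<bar>y - x\<bar> \<and> \<bar>y - x\<bar> < min d1 d2"
        have neg: "(LBINT t:{a..b}. - g t) = - (LBINT t:{a..b}. g t)" for a b
          by (simp add: set_lebesgue_integral_def)
        have *: "F b - F a \<le> (g x + e / 2) * (b - a)" "F b - F a \<ge> (g x - e / 2) * (b - a)"
          if "a = min x y" "b = max x y" for a b
          using d1(2)[of a b] d2(2)[of a b] y that F[of a b]
          by (auto simp: neg algebra_simps max_def min_def split: if_splits)
        have "(F y - F x) / (y - x) = (F (max x y) - F (min x y)) / (max x y - min x y)"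
          using minus_divide_divide[of "F y - F x" "y - x"] by (simp add: max_def min_def)
        moreover have "(F (max x y) - F (min x y)) / (max x y - min x y) \<le> g x + e / 2"
          "g x - e / 2 \<le> (F (max x y) - F (min x y)) / (max x y - min x y)"
          using *[OF refl refl] y by (auto simp: pos_divide_le_eq pos_le_divide_eq max_def min_def)
        ultimately show "\<bar>(F y - F x) / (y - x) - g x\<bar> < e" using \<open>e > 0\<close> by linarith
      qed
    qed
    then show "(F has_real_derivative g x) (at x)"
      unfolding has_field_derivative_iff LIM_def by (simp add: dist_real_def)
  qed
qed

section \<open>Differentiability of Lipschitz distribution functions\<close>

lemma continuous_on_mono_lipschitz:
  fixes f :: "real \<Rightarrow> real"
  assumes mono: "\<And>x y. x \<le> y \<Longrightarrow> f x \<le> f y"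
    and lip: "\<And>x y. x \<le> y \<Longrightarrow> f y - f x \<le> y - x"
  shows "continuous_on UNIV f"
proof (rule lipschitz_on_continuous_on[of 1], rule lipschitz_onI)
  show "dist (f x) (f y) \<le> 1 * dist x y" for x y
    using mono[of x y] mono[of y x] lip[of x y] lip[of y x]
    by (cases "x \<le> y") (simp_all add: dist_real_def)
qed auto

text \<open>The functions $f$ and $x - f(x)$ are both increasing, and the sum of their interval measures is
Lebesgue measure. Hence the interval measure of $f$ is absolutely continuous, and the
Radon--Nikodym theorem yields the density.\<close>

lemma lipschitz_cdf_density:
  fixes f :: "real \<Rightarrow> real"
  assumes mono: "\<And>x y. x \<le> y \<Longrightarrow> f x \<le> f y"
    and lip: "\<And>x y. x \<le> y \<Longrightarrow> f y - f x \<le> y - x"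
    and bot: "(f \<longlongrightarrow> 0) at_bot" and top: "(f \<longlongrightarrow> m) at_top"
  obtains g where "integrable lborel g"
    "\<And>a b. a \<le> b \<Longrightarrow> f b - f a = (LBINT t:{a..b}. g t)"
proof -
  have cont: "continuous_on UNIV f" by (rule continuous_on_mono_lipschitz[OF mono lip])
  define f' where "f' x = x - f x" for x
  have mono': "f' x \<le> f' y" if "x \<le> y" for x y using lip[OF that] by (simp add: f'_def)
  have cont': "continuous_on UNIV f'" unfolding f'_def by (intro continuous_intros cont)
  have rc: "continuous (at_right a) f" for a
    using cont by (simp add: continuous_on_eq_continuous_at continuous_at_imp_continuous_at_within)
  have m: "0 \<le> m"
  proof -
    have "0 \<le> f 0"
      by (rule tendsto_upperbound[OF bot])
        (auto simp: eventually_at_bot_linorder intro!: mono exI[of _ 0])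
    moreover have "f 0 \<le> m"
      by (rule tendsto_lowerbound[OF top])
        (auto simp: eventually_at_top_linorder intro!: mono exI[of _ 0])
    ultimately show ?thesis by simp
  qed
  define \<nu> where "\<nu> = interval_measure f"
  define \<nu>' where "\<nu>' = interval_measure f'"
  have [simp, measurable_cong]: "sets \<nu> = sets borel" "sets \<nu>' = sets borel"
    by (simp_all add: \<nu>_def \<nu>'_def)
  have Icc: "emeasure \<nu> {a..b} = ennreal (f b - f a)"
      "emeasure \<nu>' {a..b} = ennreal (f' b - f' a)" if "a \<le> b" for a b
    using emeasure_interval_measure_Icc[OF that mono cont]
      emeasure_interval_measure_Icc[OF that mono' cont'] by (simp_all add: \<nu>_def \<nu>'_def)
  have Ioo: "emeasure K {a<..<b} = emeasure K {a..b}" if K: "K = \<nu> \<or> K = \<nu>'" for a b K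
  proof -
    have null: "{c} \<in> null_sets K" for c
      using K Icc[of c c] by (auto simp: null_sets_def)
    have "{a, b} \<in> null_sets K"
      using null_sets.Un[OF null[of a] null[of b]] by (simp add: insert_commute)
    moreover have sK: "sets K = sets borel" using K by (elim disjE) simp_all
    ultimately have "emeasure K ({a<..<b} \<union> {a, b}) = emeasure K {a<..<b}"
      "emeasure K ({a..b} \<union> {a, b}) = emeasure K {a..b}"
      by (simp_all only: emeasure_Un_null_set sK sets.Diff borel_closed borel_open closed_atLeastAtMost open_greaterThanLessThan)
    moreover have "{a<..<b} \<union> {a, b} = {a..b} \<union> {a, b}" by auto
    ultimately show ?thesis by simp
  qed
  define L where "L = measure_of UNIV (sets borel) (\<lambda>A. emeasure \<nu> A + emeasure \<nu>' A)"
  have sL: "sets L = sets borel"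
    by (simp add: L_def sets.sigma_sets_eq[of borel, unfolded space_borel])
  have eL: "emeasure L A = emeasure \<nu> A + emeasure \<nu>' A" if "A \<in> sets borel" for A
  proof (rule emeasure_measure_of[OF L_def])
    show "countably_additive (sets L) (\<lambda>A. emeasure \<nu> A + emeasure \<nu>' A)"
    proof (rule countably_additiveI)
      fix A :: "nat \<Rightarrow> real set" assume A: "range A \<subseteq> sets L" "disjoint_family A"
      have "(\<Sum>i. emeasure \<nu> (A i) + emeasure \<nu>' (A i)) =
          (\<Sum>i. emeasure \<nu> (A i)) + (\<Sum>i. emeasure \<nu>' (A i))"
        by (rule suminf_add[OF summableI summableI, symmetric])
      also have "(\<Sum>i. emeasure \<nu> (A i)) = emeasure \<nu> (\<Union>i. A i)"
        using A by (intro suminf_emeasure) (simp_all add: sL)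
      also have "(\<Sum>i. emeasure \<nu>' (A i)) = emeasure \<nu>' (\<Union>i. A i)"
        using A by (intro suminf_emeasure) (simp_all add: sL)
      finally show "(\<Sum>i. emeasure \<nu> (A i) + emeasure \<nu>' (A i)) =
          emeasure \<nu> (\<Union>i. A i) + emeasure \<nu>' (\<Union>i. A i)" .
    qed
  qed (use that sL in \<open>simp_all add: positive_def\<close>)
  have "lborel = L"
  proof (rule lborel_eqI)
    fix l u :: real assume "\<And>b. b \<in> Basis \<Longrightarrow> l \<bullet> b \<le> u \<bullet> b"
    then have "l \<le> u" by simp
    then have "emeasure L {l<..<u} = ennreal (f u - f l) + ennreal (f' u - f' l)"
      by (simp add: eL Ioo Icc)
    also have "\<dots> = ennreal (u - l)"
      using mono mono' \<open>l \<le> u\<close> by (subst ennreal_plus[symmetric]) (auto simp: f'_def)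
    finally show "emeasure L (box l u) = ennreal (\<Prod>b\<in>Basis. (u - l) \<bullet> b)"
      by simp
  qed (simp add: sL)
  have ac: "absolutely_continuous lborel \<nu>"
    unfolding absolutely_continuous_def
  proof
    fix A assume "A \<in> null_sets (lborel :: real measure)"
    then have "A \<in> sets borel" "emeasure L A = 0" by (auto simp: \<open>lborel = L\<close>[symmetric])
    then show "A \<in> null_sets \<nu>" by (auto simp: eL)
  qed
  obtain r where r: "r \<in> borel_measurable lborel" "density lborel r = \<nu>"
    using sigma_finite_measure.Radon_Nikodym[OF sigma_finite_lborel ac] by auto
  have [measurable]: "r \<in> borel_measurable borel" using r by simp
  have fin: "(\<integral>\<^sup>+t. r t \<partial>lborel) = ennreal m"
    using interval_measure_UNIV[OF mono rc bot top m] r(2)[symmetric]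
    by (simp add: \<nu>_def[symmetric] emeasure_density)
  then have "AE t in lborel. r t \<noteq> \<infinity>"
    by (intro nn_integral_PInf_AE) auto
  then have fin_AE: "AE t in lborel. r t = ennreal (enn2real (r t))"
    by eventually_elim (auto simp: less_top)
  define g where "g t = enn2real (r t)" for t
  have [measurable]: "g \<in> borel_measurable borel" unfolding g_def by measurable
  have g0: "0 \<le> g t" for t by (simp add: g_def)
  have nn: "(\<integral>\<^sup>+t. ennreal (g t) \<partial>lborel) = ennreal m"
    using fin by (subst nn_integral_cong_AE[of _ r]) (use fin_AE in \<open>auto simp: g_def\<close>)
  have gi: "integrable lborel g"
    by (rule integrableI_nonneg) (simp_all add: nn g0)
  show thesis
  proof (rule that[OF gi])
    fix a b :: real assume "a \<le> b"
    have "ennreal (f b - f a) = (\<integral>\<^sup>+t. r t * indicator {a..b} t \<partial>lborel)"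
      using Icc(1)[OF \<open>a \<le> b\<close>] r(2)[symmetric] by (simp add: emeasure_density)
    also have "\<dots> = (\<integral>\<^sup>+t. ennreal (indicator {a..b} t * g t) \<partial>lborel)"
    proof (rule nn_integral_cong_AE)
      show "AE t in lborel. r t * indicator {a..b} t = ennreal (indicator {a..b} t * g t)"
        using fin_AE
      proof eventually_elim
        case (elim t)
        then show ?case by (cases "t \<in> {a..b}") (simp_all add: g_def)
      qed
    qed
    also have "\<dots> = ennreal (LBINT t:{a..b}. g t)"
      unfolding set_lebesgue_integral_def real_scaleR_def using integrable_mult_indicator[OF _ gi, of "{a..b}"]
      by (intro nn_integral_eq_integral) (simp_all add: g0)
    finally show "f b - f a = (LBINT t:{a..b}. g t)"
      using mono[OF \<open>a \<le> b\<close>]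
      by (subst (asm) ennreal_inj) (simp_all add: set_lebesgue_integral_def g0)
  qed
qed

text \<open>The point of this criterion is that it involves countably many quantifiers only, so that the set
of points of differentiability is measurable, jointly in any parameter on which $f$ depends
measurably. Continuity of the quotients away from $0$ passes from rational to real increments.\<close>

lemma differentiable_iff_rational_quotients_Cauchy:
  fixes f :: "real \<Rightarrow> real"
  assumes cont: "continuous_on UNIV f"
  defines "q \<equiv> \<lambda>x h. (f (x + h) - f x) / h"
  shows "(\<exists>D. (f has_real_derivative D) (at x)) \<longleftrightarrow>
    (\<forall>n. \<exists>m. \<forall>h k :: rat. 0 < \<bar>h\<bar> \<and> \<bar>h\<bar> < 1 / of_nat (Suc m) \<and> 0 < \<bar>k\<bar> \<and> \<bar>k\<bar> < 1 / of_nat (Suc m) \<longrightarrow>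
       \<bar>q x (of_rat h) - q x (of_rat k)\<bar> \<le> 1 / real (Suc n))" (is "?L \<longleftrightarrow> ?R")
proof
  assume ?L
  then obtain D where D: "(f has_real_derivative D) (at x)" by blast
  have halves: "\<bar>u - v\<bar> \<le> e" if "\<bar>u - D\<bar> < e / 2" "\<bar>v - D\<bar> < e / 2" for u v e :: real
    using that by linarith
  show ?R
  proof
    fix n
    have "\<exists>s>0. \<forall>h. h \<noteq> 0 \<and> \<bar>h\<bar> < s \<longrightarrow> \<bar>q x h - D\<bar> < 1 / real (Suc n) / 2"
      using D[unfolded DERIV_def LIM_def, rule_format, of "1 / real (Suc n) / 2"]
      by (simp add: dist_real_def q_def)
    then obtain s where s: "s > 0" "\<And>h. h \<noteq> 0 \<Longrightarrow> \<bar>h\<bar> < s \<Longrightarrow> \<bar>q x h - D\<bar> < 1 / real (Suc n) / 2"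
      by blast
    obtain m where m: "1 / real (Suc m) < s" using s(1) by (metis nat_approx_posE)
    have small: "of_rat h \<noteq> (0::real) \<and> \<bar>of_rat h\<bar> < s"
      if "0 < \<bar>h\<bar>" "\<bar>h\<bar> < 1 / of_nat (Suc m)" for h :: rat
    proof -
      have "of_rat \<bar>h\<bar> < (of_rat (1 / of_nat (Suc m)) :: real)"
        using that(2) by (simp only: of_rat_less)
      also have "\<dots> = 1 / real (Suc m)" by (simp only: of_rat_divide of_rat_1 of_rat_of_nat_eq)
      finally have "\<bar>of_rat h :: real\<bar> < 1 / real (Suc m)"
        by (simp add: abs_if of_rat_minus split: if_splits)
      then show ?thesis using that(1) m by simp
    qed
    show "\<exists>m. \<forall>h k :: rat. 0 < \<bar>h\<bar> \<and> \<bar>h\<bar> < 1 / of_nat (Suc m) \<and> 0 < \<bar>k\<bar> \<and> \<bar>k\<bar> < 1 / of_nat (Suc m) \<longrightarrow>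
       \<bar>q x (of_rat h) - q x (of_rat k)\<bar> \<le> 1 / real (Suc n)"
    proof (intro exI[of _ m] allI impI)
      fix h k :: rat
      assume "0 < \<bar>h\<bar> \<and> \<bar>h\<bar> < 1 / of_nat (Suc m) \<and> 0 < \<bar>k\<bar> \<and> \<bar>k\<bar> < 1 / of_nat (Suc m)"
      then have "\<bar>q x (of_rat h) - D\<bar> < 1 / real (Suc n) / 2" "\<bar>q x (of_rat k) - D\<bar> < 1 / real (Suc n) / 2"
        using small[of h] small[of k] s(2) by blast+
      then show "\<bar>q x (of_rat h) - q x (of_rat k)\<bar> \<le> 1 / real (Suc n)"
        by (rule halves)
    qed
  qed
next
  assume R: ?R
  have qc: "continuous_on (-{0}) (q x)"
    unfolding q_def by (intro continuous_intros continuous_on_compose2[OF cont]) auto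
  have real_quotients: "\<exists>m. \<forall>h k. 0 < \<bar>h\<bar> \<and> \<bar>h\<bar> < 1 / real (Suc m) \<and> 0 < \<bar>k\<bar> \<and> \<bar>k\<bar> < 1 / real (Suc m) \<longrightarrow>
       \<bar>q x h - q x k\<bar> \<le> 1 / real (Suc n)" for n
  proof -
    obtain m where m: "\<And>h k :: rat. 0 < \<bar>h\<bar> \<Longrightarrow> \<bar>h\<bar> < 1 / of_nat (Suc m) \<Longrightarrow> 0 < \<bar>k\<bar> \<Longrightarrow> \<bar>k\<bar> < 1 / of_nat (Suc m) \<Longrightarrow>
       \<bar>q x (of_rat h) - q x (of_rat k)\<bar> \<le> 1 / real (Suc n)"
      using R by meson
    define S where "S = {h :: real. 0 < \<bar>h\<bar> \<and> \<bar>h\<bar> < 1 / real (Suc m)}"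
    have oS: "open S" unfolding S_def
      by (intro open_Collect_conj open_Collect_less continuous_intros)
    have qS: "continuous_on S (q x)"
      by (rule continuous_on_subset[OF qc]) (auto simp: S_def)
    have dense: "\<exists>h::rat. of_rat h \<in> U" if U: "open U" "u \<in> U" for U and u :: real
    proof -
      obtain e where e: "e > 0" "ball u e \<subseteq> U" by (rule openE[OF U])
      obtain h where "u < of_rat h" "of_rat h < u + e"
        using of_rat_dense[of u "u + e"] e(1) by auto
      then have "of_rat h \<in> ball u e" by (auto simp: dist_real_def)
      then show ?thesis using e by blast
    qed
    have ratS: "0 < \<bar>h\<bar> \<and> \<bar>h\<bar> < 1 / of_nat (Suc m)" if "of_rat h \<in> S" for h :: rat
    proof -
      have "of_rat (1 / of_nat (Suc m)) = 1 / real (Suc m)"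
        by (simp only: of_rat_divide of_rat_1 of_rat_of_nat_eq)
      then have "of_rat \<bar>h\<bar> < (of_rat (1 / of_nat (Suc m)) :: real)" "h \<noteq> 0"
        using that by (auto simp: S_def abs_if of_rat_minus split: if_splits)
      then show ?thesis by (simp only: of_rat_less) simp
    qed
    have "\<bar>q x h - q x k\<bar> \<le> 1 / real (Suc n)" if hk: "h \<in> S" "k \<in> S" for h k
    proof (rule ccontr)
      assume far: "\<not> \<bar>q x h - q x k\<bar> \<le> 1 / real (Suc n)"
      have 1: "open {h \<in> S. \<bar>q x h - q x k\<bar> > c}" for k c
      proof -
        have "{h \<in> S. \<bar>q x h - q x k\<bar> > c} = S \<inter> (\<lambda>h. \<bar>q x h - q x k\<bar>) -` {c<..}" by auto
        moreover have "continuous_on S (\<lambda>h. \<bar>q x h - q x k\<bar>)" by (intro continuous_intros qS)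
        ultimately show ?thesis
          using continuous_open_preimage[OF _ oS open_greaterThan] by (simp only:)
      qed
      obtain h' :: rat where h': "of_rat h' \<in> S" "\<bar>q x (of_rat h') - q x k\<bar> > 1 / real (Suc n)"
      proof -
        have "\<exists>h'::rat. of_rat h' \<in> {a \<in> S. \<bar>q x a - q x k\<bar> > 1 / real (Suc n)}"
          by (rule dense[OF 1, of h]) (use far hk in simp)
        then show thesis using that by blast
      qed
      obtain k' :: rat where k': "of_rat k' \<in> S" "\<bar>q x (of_rat k') - q x (of_rat h')\<bar> > 1 / real (Suc n)"
      proof -
        have "\<exists>k'::rat. of_rat k' \<in> {a \<in> S. \<bar>q x a - q x (of_rat h')\<bar> > 1 / real (Suc n)}"
          by (rule dense[OF 1, of k]) (use h' hk in \<open>simp add: abs_minus_commute\<close>)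
        then show thesis using that by blast
      qed
      show False using m[of k' h'] ratS[OF h'(1)] ratS[OF k'(1)] k'(2) by linarith
    qed
    then show ?thesis unfolding S_def by blast
  qed
  have "Cauchy (\<lambda>j. q x (1 / real (Suc j)))"
  proof (rule CauchyI)
    fix e :: real assume "0 < e"
    obtain n where n: "1 / real (Suc n) < e" using \<open>0 < e\<close> by (metis nat_approx_posE)
    obtain m where m: "\<And>h k. 0 < \<bar>h\<bar> \<Longrightarrow> \<bar>h\<bar> < 1 / real (Suc m) \<Longrightarrow> 0 < \<bar>k\<bar> \<Longrightarrow> \<bar>k\<bar> < 1 / real (Suc m) \<Longrightarrow>
       \<bar>q x h - q x k\<bar> \<le> 1 / real (Suc n)" using real_quotients[of n] by blast
    show "\<exists>M. \<forall>i\<ge>M. \<forall>j\<ge>M. norm (q x (1 / real (Suc i)) - q x (1 / real (Suc j))) < e"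
    proof (intro exI[of _ "Suc m"] allI impI)
      fix i j assume "Suc m \<le> i" "Suc m \<le> j"
      then have "\<bar>q x (1 / real (Suc i)) - q x (1 / real (Suc j))\<bar> \<le> 1 / real (Suc n)"
        by (intro m) (auto simp: field_simps)
      then show "norm (q x (1 / real (Suc i)) - q x (1 / real (Suc j))) < e" using n by simp
    qed
  qed
  then obtain D where D: "(\<lambda>j. q x (1 / real (Suc j))) \<longlonglongrightarrow> D"
    using real_Cauchy_convergent convergentD by blast
  have "(f has_real_derivative D) (at x)"
    unfolding DERIV_def LIM_def
  proof (intro allI impI)
    fix e :: real assume "0 < e"
    obtain n where n: "1 / real (Suc n) < e" using \<open>0 < e\<close> by (metis nat_approx_posE)
    obtain m where m: "\<And>h k. 0 < \<bar>h\<bar> \<Longrightarrow> \<bar>h\<bar> < 1 / real (Suc m) \<Longrightarrow> 0 < \<bar>k\<bar> \<Longrightarrow> \<bar>k\<bar> < 1 / real (Suc m) \<Longrightarrow>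
       \<bar>q x h - q x k\<bar> \<le> 1 / real (Suc n)" using real_quotients[of n] by blast
    show "\<exists>s>0. \<forall>h. h \<noteq> 0 \<and> dist h 0 < s \<longrightarrow> dist ((f (x + h) - f x) / h) D < e"
    proof (intro exI[of _ "1 / real (Suc m)"] conjI allI impI)
      fix h :: real assume h: "h \<noteq> 0 \<and> dist h 0 < 1 / real (Suc m)"
      have "(\<lambda>j. \<bar>q x h - q x (1 / real (Suc j))\<bar>) \<longlonglongrightarrow> \<bar>q x h - D\<bar>"
        by (intro tendsto_intros D)
      moreover have "\<bar>q x h - q x (1 / real (Suc j))\<bar> \<le> 1 / real (Suc n)" if "j \<ge> Suc m" for j
        using h that by (intro m) (auto simp: field_simps)
      ultimately have "\<bar>q x h - D\<bar> \<le> 1 / real (Suc n)"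
        by (intro LIMSEQ_le_const2) auto
      then show "dist ((f (x + h) - f x) / h) D < e"
        using n by (simp add: q_def dist_real_def)
    qed auto
  qed
  then show ?L by blast
qed

text \<open>Fubini arguments on the unit square need the partial derivatives to be jointly measurable,
including at the points where they do not exist and \<^const>\<open>deriv\<close> has an unspecified value.\<close>

lemma borel_measurable_deriv_parametric:
  fixes f :: "'a \<Rightarrow> real \<Rightarrow> real"
  assumes f: "(\<lambda>(w, x). f w x) \<in> borel_measurable (M \<Otimes>\<^sub>M borel)"
    and cont: "\<And>w. w \<in> space M \<Longrightarrow> continuous_on UNIV (f w)"
  shows "(\<lambda>(w, x). deriv (f w) x) \<in> borel_measurable (M \<Otimes>\<^sub>M borel)"
proof -
  define q where "q h p = (f (fst p) (snd p + h) - f (fst p) (snd p)) / h" for h p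
  have shift: "(\<lambda>p. f (fst p) (snd p + h)) \<in> borel_measurable (M \<Otimes>\<^sub>M borel)" for h
  proof -
    have "(\<lambda>p. (fst p, snd p + h)) \<in> measurable (M \<Otimes>\<^sub>M borel) (M \<Otimes>\<^sub>M borel)" by measurable
    from measurable_compose[OF this f] show ?thesis by simp
  qed
  have [measurable]: "q h \<in> borel_measurable (M \<Otimes>\<^sub>M borel)" for h
    unfolding q_def using shift[of h] shift[of 0, simplified] by measurable
  define P where "P p \<longleftrightarrow> (\<forall>n. \<exists>m. \<forall>h k :: rat. 0 < \<bar>h\<bar> \<and> \<bar>h\<bar> < 1 / of_nat (Suc m) \<and> 0 < \<bar>k\<bar> \<and> \<bar>k\<bar> < 1 / of_nat (Suc m) \<longrightarrow>
       \<bar>q (of_rat h) p - q (of_rat k) p\<bar> \<le> 1 / real (Suc n))" for p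
  have [measurable]: "Measurable.pred (M \<Otimes>\<^sub>M borel) P"
    unfolding P_def by measurable
  \<comment> \<open>Where no derivative exists, \<^const>\<open>deriv\<close> chooses from the empty predicate, a fixed constant.\<close>
  have "deriv (f (fst p)) (snd p) = (if P p then lim (\<lambda>j. q (1 / real (Suc j)) p) else (SOME D. False))"
    if "p \<in> space (M \<Otimes>\<^sub>M borel)" for p
  proof -
    have iff: "(\<exists>D. (f (fst p) has_real_derivative D) (at (snd p))) \<longleftrightarrow> P p"
      unfolding P_def q_def
      by (rule differentiable_iff_rational_quotients_Cauchy)
        (use that cont in \<open>auto simp: space_pair_measure\<close>)
    show ?thesis
    proof (cases "P p")
      case True
      then obtain D where D: "(f (fst p) has_real_derivative D) (at (snd p))" using iff by blast
      have lim: "(\<lambda>j. q (1 / real (Suc j)) p) \<longlonglongrightarrow> D"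
        unfolding q_def
        by (rule filterlim_compose[OF D[unfolded DERIV_def]])
          (auto simp: filterlim_at LIMSEQ_Suc[OF lim_1_over_n, simplified] intro!: always_eventually)
      then show ?thesis using True DERIV_imp_deriv[OF D] limI[OF lim] by simp
    next
      case False
      then have "(\<lambda>D. (f (fst p) has_real_derivative D) (at (snd p))) = (\<lambda>D. False)" using iff by blast
      then show ?thesis using False by (simp add: deriv_def)
    qed
  qed
  then have "(\<lambda>p. deriv (f (fst p)) (snd p)) \<in> borel_measurable (M \<Otimes>\<^sub>M borel)"
    by (subst measurable_cong[where g="\<lambda>p. if P p then lim (\<lambda>j. q (1 / real (Suc j)) p) else (SOME D. False)"]) auto
  then show ?thesis by (simp add: case_prod_beta)
qed

theorem lipschitz_cdf_derivative:
  fixes f :: "real \<Rightarrow> real"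
  assumes mono: "\<And>x y. x \<le> y \<Longrightarrow> f x \<le> f y"
    and lip: "\<And>x y. x \<le> y \<Longrightarrow> f y - f x \<le> y - x"
    and bot: "(f \<longlongrightarrow> 0) at_bot" and top: "(f \<longlongrightarrow> m) at_top"
  shows "AE x in lborel. (f has_real_derivative deriv f x) (at x)"
    and "a \<le> b \<Longrightarrow> (LBINT t:{a..b}. deriv f t) = f b - f a"
proof -
  obtain g where g: "integrable lborel g" "\<And>a b. a \<le> b \<Longrightarrow> f b - f a = (LBINT t:{a..b}. g t)"
    by (rule lipschitz_cdf_density[OF assms]) (assumption | rule that)+
  have D: "AE x in lborel. (f has_real_derivative g x) (at x)"
    using lebesgue_differentiation[OF g] .
  then show "AE x in lborel. (f has_real_derivative deriv f x) (at x)"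
    by eventually_elim (simp add: DERIV_imp_deriv)
  have cont: "continuous_on UNIV f" by (rule continuous_on_mono_lipschitz[OF mono lip])
  have "(\<lambda>(w :: real, x). f x) \<in> borel_measurable (borel \<Otimes>\<^sub>M borel)"
    unfolding case_prod_beta
    by (rule measurable_compose[OF measurable_snd borel_measurable_continuous_onI[OF cont]])
  then have "(\<lambda>(w :: real, x). deriv f x) \<in> borel_measurable (borel \<Otimes>\<^sub>M borel)"
    by (rule borel_measurable_deriv_parametric) (rule cont)
  from measurable_compose[OF measurable_Pair1' this, of 0]
  have [measurable]: "deriv f \<in> borel_measurable borel" by simp
  have [measurable]: "g \<in> borel_measurable borel" using borel_measurable_integrable[OF g(1)] by simp
  assume "a \<le> b"
  have "(LBINT t:{a..b}. deriv f t) = (LBINT t:{a..b}. g t)"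
    unfolding set_lebesgue_integral_def
    by (intro integral_cong_AE) (use D in \<open>auto simp: DERIV_imp_deriv elim!: eventually_mono\<close>)
  then show "(LBINT t:{a..b}. deriv f t) = f b - f a" using g(2)[OF \<open>a \<le> b\<close>] by simp
qed

section \<open>Partial derivatives of copulas\<close>

abbreviation unif :: "real measure" where
  "unif \<equiv> restrict_space lborel {0<..<1}"

lemma prob_space_unif: "prob_space unif"
  by (auto simp: emeasure_restrict_space space_restrict_space intro!: prob_spaceI)

interpretation unif: prob_space unif by (rule prob_space_unif)
interpretation unif2: pair_prob_space unif unif ..

lemma space_unif [simp]: "space unif = {0<..<1}"
  by (simp add: space_restrict_space)

lemma measurable_unif_id [simp]: "(\<lambda>x. x) \<in> borel_measurable unif"
  by (rule measurable_restrict_space1) simp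

lemma measurable_unif:
  "f \<in> measurable borel N \<Longrightarrow> f \<in> measurable unif N"
  by (rule measurable_restrict_space1) simp

lemma AE_unif: "(AE x in unif. P x) \<longleftrightarrow> (AE x in lborel. 0 < x \<and> x < 1 \<longrightarrow> P x)"
  by (subst AE_restrict_space_iff) auto

lemma AE_unif_lborelI: "AE x in lborel. P x \<Longrightarrow> AE x in unif. P x"
  unfolding AE_unif by (auto elim: eventually_mono)

lemma AE_unif_neq: "AE x in unif. x \<noteq> c"
  by (rule AE_unif_lborelI[OF AE_lborel_singleton])

lemma LBINT_unit_interval: "(LBINT x:{0..1}. f x) = (LINT x|unif. f x :: real)"
proof -
  have "(LBINT x:{0..1}. f x) = (LBINT x:{0<..<1}. f x)"
    by (rule set_integral_discrete_difference[where X="{0, 1}"]) auto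
  then show ?thesis by (subst integral_restrict_space) (auto simp: set_lebesgue_integral_def)
qed

text \<open>A copula is extended to the plane by retracting each coordinate to the unit interval. The sections
of the extension are Lipschitz distribution functions on the whole line, and inside the square
nothing changes, whereas the values of a copula outside the square are undefined.\<close>

definition clamp01 :: "real \<Rightarrow> real" where
  "clamp01 x = max 0 (min 1 x)"

lemma clamp01_simps [simp]:
  "0 \<le> clamp01 x" "clamp01 x \<le> 1" "x \<le> 0 \<Longrightarrow> clamp01 x = 0" "1 \<le> x \<Longrightarrow> clamp01 x = 1"
  "0 \<le> x \<Longrightarrow> x \<le> 1 \<Longrightarrow> clamp01 x = x"
  by (auto simp: clamp01_def)

lemma clamp01_mono: "x \<le> y \<Longrightarrow> clamp01 x \<le> clamp01 y"
  and clamp01_lipschitz: "x \<le> y \<Longrightarrow> clamp01 y - clamp01 x \<le> y - x"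
  by (auto simp: clamp01_def)

definition extend :: "(real \<times> real \<Rightarrow> real) \<Rightarrow> real \<Rightarrow> real \<Rightarrow> real" where
  "extend C x y = C (clamp01 x, clamp01 y)"

text \<open>Transposition exchanges the two variables, so that facts about the second partial derivative
follow from those about the first.\<close>

definition flip :: "(real \<times> real \<Rightarrow> real) \<Rightarrow> real \<times> real \<Rightarrow> real" where
  "flip C = (\<lambda>(x, y)\<in>unit_square. C (y, x))"

definition d1 :: "(real \<times> real \<Rightarrow> real) \<Rightarrow> real \<Rightarrow> real \<Rightarrow> real" where
  "d1 C x y = deriv (\<lambda>s. extend C s y) x"

definition d2 :: "(real \<times> real \<Rightarrow> real) \<Rightarrow> real \<Rightarrow> real \<Rightarrow> real" where
  "d2 C x y = deriv (\<lambda>t. extend C x t) y"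

lemma extend_eq: "0 \<le> x \<Longrightarrow> x \<le> 1 \<Longrightarrow> 0 \<le> y \<Longrightarrow> y \<le> 1 \<Longrightarrow> extend C x y = C (x, y)"
  by (simp add: extend_def)

lemma extend_flip: "extend (flip C) x y = extend C y x"
  by (simp add: extend_def flip_def)

lemma d2_flip: "d2 (flip C) x y = d1 C y x" and d1_flip: "d1 (flip C) x y = d2 C y x"
  by (simp_all add: d1_def d2_def extend_flip)

lemma copula_eqI:
  assumes "C \<in> copulas" "D \<in> copulas"
    and "\<And>x y. 0 \<le> x \<Longrightarrow> x \<le> 1 \<Longrightarrow> 0 \<le> y \<Longrightarrow> y \<le> 1 \<Longrightarrow> C (x, y) = D (x, y)"
  shows "C = D"
proof (rule PiE_ext)
  show "C \<in> unit_square \<rightarrow>\<^sub>E {0..1}" "D \<in> unit_square \<rightarrow>\<^sub>E {0..1}"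
    using assms(1,2) by (auto simp: copulas_def)
qed (use assms(3) in auto)

lemma flip_copula: "C \<in> copulas \<Longrightarrow> flip C \<in> copulas"
  unfolding copulas_def flip_def
  by (auto simp: PiE_iff extensional_def) (smt (verit, best) atLeastAtMost_iff)

lemma flip_flip: "C \<in> copulas \<Longrightarrow> flip (flip C) = C"
  by (rule copula_eqI) (auto simp: flip_copula, auto simp: flip_def)

lemma partial1_eq:
  assumes "0 < x" "x < 1" "0 \<le> y" "y \<le> 1"
  shows "partial1 C x y = d1 C x y"
  unfolding partial1_def d1_def
proof (rule deriv_cong_ev)
  have "\<forall>\<^sub>F s in nhds x. s \<in> {0<..<1}" using assms by (intro eventually_nhds_in_open) auto
  then show "\<forall>\<^sub>F s in nhds x. C (s, y) = extend C s y"
    by eventually_elim (use assms in \<open>simp add: extend_eq\<close>)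
qed simp

lemma partial2_eq:
  assumes "0 \<le> x" "x \<le> 1" "0 < y" "y < 1"
  shows "partial2 C x y = d2 C x y"
  unfolding partial2_def d2_def
proof (rule deriv_cong_ev)
  have "\<forall>\<^sub>F s in nhds y. s \<in> {0<..<1}" using assms by (intro eventually_nhds_in_open) auto
  then show "\<forall>\<^sub>F s in nhds y. C (x, s) = extend C x s"
    by eventually_elim (use assms in \<open>simp add: extend_eq\<close>)
qed simp

lemma star_prod_eq:
  assumes "0 \<le> x" "x \<le> 1" "0 \<le> y" "y \<le> 1"
  shows "star_prod A B (x, y) = (LINT t|unif. d2 A x t * d1 B t y)"
proof -
  have "star_prod A B (x, y) = (LBINT t:{0..1}. partial2 A x t * partial1 B t y)"
    using assms by (simp add: star_prod_def)
  also have "\<dots> = (LINT t|unif. partial2 A x t * partial1 B t y)" by (rule LBINT_unit_interval)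
  also have "\<dots> = (LINT t|unif. d2 A x t * d1 B t y)"
    by (intro Bochner_Integration.integral_cong) (use assms in \<open>auto simp: partial1_eq partial2_eq\<close>)
  finally show ?thesis .
qed

lemma sobolev_norm_eq:
  "sobolev_norm A = sqrt (LINT y|unif. LINT x|unif. (d1 A x y)\<^sup>2 + (d2 A x y)\<^sup>2)"
  unfolding sobolev_norm_def LBINT_unit_interval
  by (auto intro!: arg_cong[where f=sqrt] Bochner_Integration.integral_cong simp: partial1_eq partial2_eq)

lemma flip_star_prod: "star_prod (flip B) (flip A) = flip (star_prod A B)"
proof
  fix p :: "real \<times> real"
  obtain x y where p: "p = (x, y)" by (cases p)
  show "star_prod (flip B) (flip A) p = flip (star_prod A B) p"
  proof (cases "p \<in> unit_square")
    case True
    then show ?thesis by (simp add: p star_prod_eq flip_def[of "star_prod A B"] d1_flip d2_flip mult.commute)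
  next
    case False
    then have "star_prod A' B' p = undefined" "flip C p = undefined" for A' B' C
      by (simp_all only: star_prod_def flip_def restrict_apply if_False)
    then show ?thesis by simp
  qed
qed

lemma derivative_le_of_increment_le:
  fixes f g :: "real \<Rightarrow> real"
  assumes "\<And>x y. x \<le> y \<Longrightarrow> f y - f x \<le> g y - g x"
    and "(f has_real_derivative D) (at x)" "(g has_real_derivative E) (at x)"
  shows "D \<le> E"
proof -
  have "mono_on UNIV (\<lambda>x. g x - f x)"
    using assms(1) by (auto intro!: mono_onI simp: algebra_simps)
  moreover have "((\<lambda>x. g x - f x) has_real_derivative E - D) (at x)"
    by (intro derivative_intros assms)
  ultimately have "0 \<le> E - D" by (rule mono_on_imp_deriv_nonneg) simp
  then show ?thesis by simp
qed

context
  fixes C assumes C: "C \<in> copulas"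
begin

lemma extend_boundary:
  "x \<le> 0 \<Longrightarrow> extend C x y = 0" "y \<le> 0 \<Longrightarrow> extend C x y = 0"
  "1 \<le> x \<Longrightarrow> extend C x y = clamp01 y" "1 \<le> y \<Longrightarrow> extend C x y = clamp01 x"
  using C by (auto simp: copulas_def extend_def)

lemma extend_2_increasing:
  assumes "x \<le> u" "y \<le> v"
  shows "extend C x v - extend C x y \<le> extend C u v - extend C u y"
proof -
  have "C (clamp01 u, clamp01 v) - C (clamp01 u, clamp01 y) - C (clamp01 x, clamp01 v) + C (clamp01 x, clamp01 y) \<ge> 0"
    using C clamp01_mono[OF assms(1)] clamp01_mono[OF assms(2)] by (auto simp: copulas_def)
  then show ?thesis by (simp add: extend_def)
qed

lemma extend_mono1: "x \<le> u \<Longrightarrow> extend C x y \<le> extend C u y"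
  using extend_2_increasing[of x u "min 0 y" y] by (simp add: extend_boundary)

lemma extend_lipschitz1: "x \<le> u \<Longrightarrow> extend C u y - extend C x y \<le> u - x"
  using extend_2_increasing[of x u y "max 1 y"] clamp01_lipschitz[of x u] by (simp add: extend_boundary)

end

lemma extend_mono2: "C \<in> copulas \<Longrightarrow> x \<le> u \<Longrightarrow> extend C y x \<le> extend C y u"
  using extend_mono1[OF flip_copula, of C x u y] by (simp add: extend_flip)

lemma extend_lipschitz2: "C \<in> copulas \<Longrightarrow> x \<le> u \<Longrightarrow> extend C y u - extend C y x \<le> u - x"
  using extend_lipschitz1[OF flip_copula, of C x u y] by (simp add: extend_flip)

context
  fixes C assumes C: "C \<in> copulas"
begin

lemma continuous_on_extend1: "continuous_on UNIV (\<lambda>x. extend C x y)"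
  by (rule continuous_on_mono_lipschitz) (auto intro: extend_mono1[OF C] extend_lipschitz1[OF C])

lemma continuous_on_extend: "continuous_on UNIV (\<lambda>p. extend C (fst p) (snd p))"
proof (rule lipschitz_on_continuous_on[of 2], rule lipschitz_onI)
  fix p q :: "real \<times> real"
  obtain x y u v where pq: "p = (x, y)" "q = (u, v)" by (cases p, cases q)
  have "\<bar>extend C x y - extend C u y\<bar> \<le> \<bar>x - u\<bar>"
    using extend_mono1[OF C, of x u y] extend_mono1[OF C, of u x y]
      extend_lipschitz1[OF C, of x u y] extend_lipschitz1[OF C, of u x y] by (cases "x \<le> u") auto
  moreover have "\<bar>extend C u y - extend C u v\<bar> \<le> \<bar>y - v\<bar>"
    using extend_mono2[OF C, of y v u] extend_mono2[OF C, of v y u]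
      extend_lipschitz2[OF C, of y v u] extend_lipschitz2[OF C, of v y u] by (cases "y \<le> v") auto
  ultimately have "\<bar>extend C x y - extend C u v\<bar> \<le> \<bar>x - u\<bar> + \<bar>y - v\<bar>" by linarith
  also have "\<dots> \<le> 2 * dist p q"
    using dist_fst_le[of p q] dist_snd_le[of p q] by (simp add: pq dist_real_def)
  finally show "dist (extend C (fst p) (snd p)) (extend C (fst q) (snd q)) \<le> 2 * dist p q"
    by (simp add: pq dist_real_def)
qed auto

lemma measurable_d1:
  assumes [measurable]: "f \<in> borel_measurable N" "g \<in> borel_measurable N"
  shows "(\<lambda>w. d1 C (f w) (g w)) \<in> borel_measurable N"
proof -
  have "(\<lambda>p. extend C (fst p) (snd p)) \<in> borel_measurable (borel \<Otimes>\<^sub>M borel)"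
    unfolding borel_prod by (rule borel_measurable_continuous_onI[OF continuous_on_extend])
  from measurable_compose[OF measurable_pair_swap' this]
  have "(\<lambda>(y, s). extend C s y) \<in> borel_measurable (borel \<Otimes>\<^sub>M borel)"
    by (simp add: case_prod_beta)
  then have "(\<lambda>(y, x). deriv (\<lambda>s. extend C s y) x) \<in> borel_measurable (borel \<Otimes>\<^sub>M borel)"
    by (rule borel_measurable_deriv_parametric) (rule continuous_on_extend1)
  from measurable_compose[OF _ this, of "\<lambda>w. (g w, f w)" N]
  show ?thesis by (simp add: d1_def)
qed

lemma d1_differentiable: "AE x in unif. ((\<lambda>s. extend C s y) has_real_derivative d1 C x y) (at x)"
  and d1_FTC: "a \<le> b \<Longrightarrow> (LBINT t:{a..b}. d1 C t y) = extend C b y - extend C a y"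
proof -
  note mono = extend_mono1[OF C] and lip = extend_lipschitz1[OF C]
  have bot: "((\<lambda>s. extend C s y) \<longlongrightarrow> 0) at_bot"
    by (rule tendsto_eventually) (auto simp: eventually_at_bot_linorder intro!: exI[of _ 0] extend_boundary(1)[OF C])
  have top: "((\<lambda>s. extend C s y) \<longlongrightarrow> clamp01 y) at_top"
    by (rule tendsto_eventually) (auto simp: eventually_at_top_linorder intro!: exI[of _ 1] extend_boundary(3)[OF C])
  show "AE x in unif. ((\<lambda>s. extend C s y) has_real_derivative d1 C x y) (at x)"
    unfolding d1_def by (rule AE_unif_lborelI[OF lipschitz_cdf_derivative(1)[OF mono lip bot top]])
  show "a \<le> b \<Longrightarrow> (LBINT t:{a..b}. d1 C t y) = extend C b y - extend C a y"
    unfolding d1_def by (rule lipschitz_cdf_derivative(2)[OF mono lip bot top])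
qed

lemma d1_bounds: "AE x in unif. 0 \<le> d1 C x y \<and> d1 C x y \<le> 1"
  using d1_differentiable[of y]
proof eventually_elim
  case (elim x)
  have "((\<lambda>s. 0) has_real_derivative 0) (at x)" "((\<lambda>s. s) has_real_derivative 1) (at x)"
    by (auto intro!: derivative_eq_intros)
  then show ?case
    using derivative_le_of_increment_le[OF _ _ elim, of "\<lambda>s. 0" 0]
      derivative_le_of_increment_le[OF _ elim, of "\<lambda>s. s" 1]
      extend_mono1[OF C] extend_lipschitz1[OF C] by auto
qed

text \<open>The difference of two horizontal sections of a copula is increasing because copulas are
2-increasing.\<close>

lemma d1_mono: "y \<le> v \<Longrightarrow> AE x in unif. d1 C x y \<le> d1 C x v"
  using d1_differentiable[of y] d1_differentiable[of v]
proof eventually_elim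
  case (elim x)
  show ?case
    by (rule derivative_le_of_increment_le[OF _ elim(2,3)])
      (use extend_2_increasing[OF C _ elim(1)] in \<open>auto simp: algebra_simps\<close>)
qed

lemma integrable_d1: "integrable unif (\<lambda>x. d1 C x y)"
  using d1_bounds[of y]
  by (intro unif.integrable_const_bound[where B=1] measurable_d1) (auto elim: eventually_mono)

lemma integral_d1_upto:
  assumes "0 \<le> a" "a \<le> 1"
  shows "(LINT t|unif. indicator {..a} t * d1 C t y) = extend C a y"
proof -
  have [measurable]: "(\<lambda>t. d1 C t y) \<in> borel_measurable borel" by (intro measurable_d1) auto
  have "(LINT t|unif. indicator {..a} t * d1 C t y) = (LBINT t:{0..1}. indicator {..a} t * d1 C t y)"
    by (rule LBINT_unit_interval[symmetric])
  also have "\<dots> = (LBINT t:{0..a}. d1 C t y)"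
    unfolding set_lebesgue_integral_def using assms
    by (intro Bochner_Integration.integral_cong) (auto split: split_indicator)
  also have "\<dots> = extend C a y" using d1_FTC[OF assms(1)] by (simp add: extend_boundary[OF C])
  finally show ?thesis .
qed

lemma integral_d1: "(LINT t|unif. d1 C t y) = clamp01 y"
proof -
  have "(LINT t|unif. d1 C t y) = (LINT t|unif. indicator {..1} t * d1 C t y)"
    by (intro Bochner_Integration.integral_cong) auto
  then show ?thesis using integral_d1_upto[of 1 y] by (simp add: extend_boundary[OF C])
qed

lemma d1_boundary:
  assumes "0 < t" "t < 1"
  shows "y \<le> 0 \<Longrightarrow> d1 C t y = 0" "1 \<le> y \<Longrightarrow> d1 C t y = 1"
proof -
  show "y \<le> 0 \<Longrightarrow> d1 C t y = 0" by (simp add: d1_def extend_boundary[OF C])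
  assume "1 \<le> y"
  have "\<forall>\<^sub>F s in nhds t. s \<in> {0<..<1}" using assms by (intro eventually_nhds_in_open) auto
  then have "\<forall>\<^sub>F s in nhds t. extend C s y = s"
    by eventually_elim (simp add: extend_boundary[OF C] \<open>1 \<le> y\<close>)
  then have "d1 C t y = deriv (\<lambda>s. s) t" unfolding d1_def by (rule deriv_cong_ev) simp
  then show "d1 C t y = 1" by simp
qed

end

lemmas measurable_d2 = measurable_d1[OF flip_copula, unfolded d1_flip]
lemmas d2_bounds = d1_bounds[OF flip_copula, unfolded d1_flip]
lemmas d2_mono = d1_mono[OF flip_copula, unfolded d1_flip]
lemmas d2_boundary = d1_boundary[OF flip_copula, unfolded d1_flip]
lemmas integral_d2 = integral_d1[OF flip_copula, unfolded d1_flip]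

section \<open>The star product and the Sobolev norm\<close>

lemma integrable_star_integrand:
  assumes "A \<in> copulas" "B \<in> copulas"
  shows "integrable unif (\<lambda>t. d2 A x t * d1 B t y)"
proof (rule unif.integrable_const_bound[where B=1])
  show "AE t in unif. norm (d2 A x t * d1 B t y) \<le> 1"
    using d2_bounds[OF assms(1), of x] d1_bounds[OF assms(2), of y]
    by eventually_elim (auto simp: abs_mult intro: mult_le_one)
qed (intro borel_measurable_times measurable_d2 measurable_d1 assms; simp)

text \<open>The rectangle inequality holds because the mixed increment of the product is the integral of
$(D_2A(u,t) - D_2A(x,t))(D_1B(t,v) - D_1B(t,y))$, whose factors are nonnegative almost everywhere.\<close>

theorem star_prod_copula:
  assumes A: "A \<in> copulas" and B: "B \<in> copulas"
  shows "star_prod A B \<in> copulas"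
proof -
  note int = integrable_star_integrand[OF A B]
  have bounds: "AE t in unif. 0 \<le> d2 A x t * d1 B t y \<and> d2 A x t * d1 B t y \<le> 1" for x y
    using d2_bounds[OF A, of x] d1_bounds[OF B, of y]
    by eventually_elim (auto intro: mult_le_one)
  have range: "star_prod A B (x, y) \<in> {0..1}" if "x \<in> {0..1}" "y \<in> {0..1}" for x y
    using that bounds[of x y]
    by (auto simp: star_prod_eq intro!: integral_nonneg_AE unif.integral_le_const int elim: eventually_mono)
  have "star_prod A B (x, 0) = 0 \<and> star_prod A B (0, x) = 0
      \<and> star_prod A B (x, 1) = x \<and> star_prod A B (1, x) = x" if "x \<in> {0..1}" for x
  proof -
    have "(LINT t|unif. d2 A x t * d1 B t 0) = (LINT t|unif. 0)"
      "(LINT t|unif. d2 A 0 t * d1 B t x) = (LINT t|unif. 0)"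
      "(LINT t|unif. d2 A x t * d1 B t 1) = (LINT t|unif. d2 A x t)"
      "(LINT t|unif. d2 A 1 t * d1 B t x) = (LINT t|unif. d1 B t x)"
      by (rule Bochner_Integration.integral_cong;
          simp add: d1_boundary[OF B] d2_boundary[OF A])+
    then have "star_prod A B (x, 0) = 0" "star_prod A B (0, x) = 0"
      "star_prod A B (x, 1) = (LINT t|unif. d2 A x t)" "star_prod A B (1, x) = (LINT t|unif. d1 B t x)"
      using that by (simp_all add: star_prod_eq)
    then show ?thesis using that by (simp add: integral_d1[OF B] integral_d2[OF A])
  qed
  moreover have "star_prod A B (u, v) - star_prod A B (u, y) - star_prod A B (x, v) + star_prod A B (x, y) \<ge> 0"
    if "x \<in> {0..1}" "u \<in> {0..1}" "y \<in> {0..1}" "v \<in> {0..1}" "x \<le> u" "y \<le> v" for x u y v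
  proof -
    have "0 \<le> (LINT t|unif. (d2 A u t - d2 A x t) * (d1 B t v - d1 B t y))"
    proof (rule integral_nonneg_AE)
      show "AE t in unif. 0 \<le> (d2 A u t - d2 A x t) * (d1 B t v - d1 B t y)"
        using d2_mono[OF A that(5)] d1_mono[OF B that(6)] by eventually_elim auto
    qed
    also have "\<dots> = (LINT t|unif. (d2 A u t * d1 B t v - d2 A u t * d1 B t y)
        - (d2 A x t * d1 B t v - d2 A x t * d1 B t y))"
      by (simp add: algebra_simps)
    also have "\<dots> = (star_prod A B (u, v) - star_prod A B (u, y)) - (star_prod A B (x, v) - star_prod A B (x, y))"
      using that by (simp add: star_prod_eq int)
    finally show ?thesis by simp
  qed
  moreover have "star_prod A B \<in> unit_square \<rightarrow>\<^sub>E {0..1}"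
    using range by (auto simp: PiE_iff star_prod_def[of A B])
  ultimately show ?thesis by (simp add: copulas_def)
qed

lemma M_copula: "M_copula \<in> copulas"
  by (auto simp: copulas_def M_copula_def PiE_iff min_def)

lemma extend_M_copula: "extend M_copula x y = min (clamp01 x) (clamp01 y)"
  by (simp add: extend_def M_copula_def)

lemma d2_M_copula:
  assumes "0 < t" "t < 1" "0 \<le> x" "x \<le> 1" "t \<noteq> x"
  shows "d2 M_copula x t = indicator {..x} t"
proof (cases "t < x")
  case True
  have "\<forall>\<^sub>F s in nhds t. s \<in> {0<..<x}" using assms True by (intro eventually_nhds_in_open) auto
  then have "\<forall>\<^sub>F s in nhds t. extend M_copula x s = s"
    by eventually_elim (use assms in \<open>auto simp: extend_M_copula\<close>)
  then have "d2 M_copula x t = deriv (\<lambda>s. s) t" unfolding d2_def by (rule deriv_cong_ev) simp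
  then show ?thesis using True by simp
next
  case False
  then have "\<forall>\<^sub>F s in nhds t. s \<in> {x<..<1}" using assms by (intro eventually_nhds_in_open) auto
  then have "\<forall>\<^sub>F s in nhds t. extend M_copula x s = x"
    by eventually_elim (use assms in \<open>auto simp: extend_M_copula\<close>)
  then have "d2 M_copula x t = deriv (\<lambda>s. x) t" unfolding d2_def by (rule deriv_cong_ev) simp
  then show ?thesis using False assms by simp
qed

text \<open>As $D_2M(x,t)$ is the indicator of $t \<le> x$ up to one point, the product with $C$ is the
fundamental theorem of calculus for $C(\cdot, y)$.\<close>

lemma star_prod_M_left:
  assumes C: "C \<in> copulas"
  shows "star_prod M_copula C = C"
proof (rule copula_eqI[OF star_prod_copula[OF M_copula C] C])
  fix x y :: real assume xy: "0 \<le> x" "x \<le> 1" "0 \<le> y" "y \<le> 1"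
  have "star_prod M_copula C (x, y) = (LINT t|unif. indicator {..x} t * d1 C t y)"
    unfolding star_prod_eq[OF xy]
  proof (rule integral_cong_AE)
    show "AE t in unif. d2 M_copula x t * d1 C t y = indicator {..x} t * d1 C t y"
      using AE_unif_neq[of x] AE_space by eventually_elim (use xy in \<open>simp add: d2_M_copula\<close>)
  qed (intro measurable_unif borel_measurable_times measurable_d2 measurable_d1 M_copula C; simp)+
  then show "star_prod M_copula C (x, y) = C (x, y)"
    using xy by (simp add: integral_d1_upto[OF C] extend_eq)
qed

lemma star_prod_M_right:
  assumes C: "C \<in> copulas"
  shows "star_prod C M_copula = C"
proof -
  have M: "flip M_copula = M_copula"
    by (rule copula_eqI) (auto simp: flip_copula M_copula, auto simp: flip_def M_copula_def)
  have "star_prod C M_copula = star_prod (flip (flip C)) (flip M_copula)"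
    by (simp only: M flip_flip[OF C])
  also have "\<dots> = flip (star_prod M_copula (flip C))" by (rule flip_star_prod)
  also have "\<dots> = C" by (simp only: star_prod_M_left[OF flip_copula[OF C]] flip_flip[OF C])
  finally show ?thesis .
qed

text \<open>The bounds for the second partial derivative hold on almost all of each vertical line; joint
measurability allows exchanging the order to that of the iterated integral in the norm.\<close>

lemma AE_partials_bounds:
  assumes C: "C \<in> copulas"
  shows "AE y in unif. AE x in unif. 0 \<le> d1 C x y \<and> d1 C x y \<le> 1 \<and> 0 \<le> d2 C x y \<and> d2 C x y \<le> 1"
proof -
  note [measurable] = measurable_unif_id
  have "AE x in unif. AE y in unif. 0 \<le> d2 C x y \<and> d2 C x y \<le> 1"
    by (intro AE_I2 d2_bounds C)
  moreover have "{p \<in> space (unif \<Otimes>\<^sub>M unif). 0 \<le> d2 C (fst p) (snd p) \<and> d2 C (fst p) (snd p) \<le> 1} \<in> sets (unif \<Otimes>\<^sub>M unif)"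
  proof -
    have [measurable]: "(\<lambda>p. d2 C (fst p) (snd p)) \<in> borel_measurable (unif \<Otimes>\<^sub>M unif)"
      by (intro measurable_d2 C) measurable
    show ?thesis by measurable
  qed
  ultimately have "AE y in unif. AE x in unif. 0 \<le> d2 C x y \<and> d2 C x y \<le> 1"
    by (rule iffD1[OF unif2.AE_commute, rotated])
  then show ?thesis
  proof eventually_elim
    case (elim y)
    with d1_bounds[OF C, of y] show ?case by eventually_elim auto
  qed
qed

lemma integrable_sobolev:
  assumes C: "C \<in> copulas"
  shows "AE y in unif. integrable unif (\<lambda>x. (d1 C x y)\<^sup>2 + (d2 C x y)\<^sup>2)"
    and "integrable unif (\<lambda>y. LINT x|unif. (d1 C x y)\<^sup>2 + (d2 C x y)\<^sup>2)"
proof -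
  note [measurable] = measurable_unif_id
  show "AE y in unif. integrable unif (\<lambda>x. (d1 C x y)\<^sup>2 + (d2 C x y)\<^sup>2)"
    using AE_partials_bounds[OF C]
  proof eventually_elim
    case (elim y)
    show ?case
    proof (rule unif.integrable_const_bound[where B=2])
      show "AE x in unif. norm ((d1 C x y)\<^sup>2 + (d2 C x y)\<^sup>2) \<le> 2"
        using elim
      proof eventually_elim
        case (elim x)
        then have "(d1 C x y)\<^sup>2 \<le> 1" "(d2 C x y)\<^sup>2 \<le> 1" by (auto intro: power_le_one)
        then show ?case by simp
      qed
    qed (intro borel_measurable_add borel_measurable_power measurable_d2 measurable_d1 C; simp)
  qed
  have [measurable]: "(\<lambda>p. (d1 C (snd p) (fst p))\<^sup>2 + (d2 C (snd p) (fst p))\<^sup>2) \<in> borel_measurable (unif \<Otimes>\<^sub>M unif)"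
    by (intro borel_measurable_add borel_measurable_power measurable_d2 measurable_d1 C) measurable
  show "integrable unif (\<lambda>y. LINT x|unif. (d1 C x y)\<^sup>2 + (d2 C x y)\<^sup>2)"
  proof (rule unif.integrable_const_bound[where B=2])
    show "AE y in unif. norm (LINT x|unif. (d1 C x y)\<^sup>2 + (d2 C x y)\<^sup>2) \<le> 2"
      using AE_partials_bounds[OF C] \<open>AE y in unif. integrable unif (\<lambda>x. (d1 C x y)\<^sup>2 + (d2 C x y)\<^sup>2)\<close>
    proof eventually_elim
      case (elim y)
      have "(LINT x|unif. (d1 C x y)\<^sup>2 + (d2 C x y)\<^sup>2) \<le> 2"
        by (rule unif.integral_le_const[OF elim(2)], use elim(1) in eventually_elim)
          (smt (verit) power_le_one)
      then show ?case by (simp add: integral_nonneg_AE)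
    qed
    show "(\<lambda>y. LINT x|unif. (d1 C x y)\<^sup>2 + (d2 C x y)\<^sup>2) \<in> borel_measurable unif"
      using unif.borel_measurable_lebesgue_integral[of "\<lambda>y x. (d1 C x y)\<^sup>2 + (d2 C x y)\<^sup>2" unif]
      by (simp add: case_prod_beta)
  qed
qed

text \<open>Values in the unit interval are decreased by squaring, and the unsquared derivatives integrate to
$\int_0^1 y\,dy = 1/2$ each.\<close>

theorem sobolev_norm_le_1:
  assumes C: "C \<in> copulas"
  shows "sobolev_norm C \<le> 1"
proof -
  note [measurable] = measurable_unif_id
  have [measurable]: "(\<lambda>p. d2 C (fst p) (snd p)) \<in> borel_measurable (unif \<Otimes>\<^sub>M unif)"
    by (intro measurable_d2 C) measurable
  have "AE p in unif \<Otimes>\<^sub>M unif. norm (d2 C (fst p) (snd p)) \<le> 1"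
  proof (rule unif2.AE_pair_measure)
    show "{p \<in> space (unif \<Otimes>\<^sub>M unif). norm (d2 C (fst p) (snd p)) \<le> 1} \<in> sets (unif \<Otimes>\<^sub>M unif)"
      by measurable
    have "AE y in unif. norm (d2 C x y) \<le> 1" for x
      using d2_bounds[OF C, of x] by eventually_elim auto
    then show "AE x in unif. AE y in unif. norm (d2 C (fst (x, y)) (snd (x, y))) \<le> 1" by simp
  qed
  then have int2: "integrable (unif \<Otimes>\<^sub>M unif) (\<lambda>(x, y). d2 C x y)"
    unfolding case_prod_beta by (intro unif2.integrable_const_bound[where B=1]) auto
  have swap: "(LINT y|unif. LINT x|unif. d2 C x y) = (LINT x|unif. LINT y|unif. d2 C x y)"
    by (rule unif2.Fubini_integral[OF int2])
  have half: "(LINT x|unif. clamp01 x) = 1 / 2"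
  proof -
    have "(LINT x|unif. clamp01 x) = (LINT x|unif. x)"
      by (intro Bochner_Integration.integral_cong) auto
    also have "\<dots> = (LBINT x:{0..1}. x)" by (rule LBINT_unit_interval[symmetric])
    also have "\<dots> = 1 / 2"
    proof -
      have "((\<lambda>x. x\<^sup>2 / 2) has_real_derivative x) (at x)" for x :: real
        by (auto intro!: derivative_eq_intros)
      then show ?thesis
        using integral_FTC_Icc_real[of 0 1 "\<lambda>x. x\<^sup>2 / 2" "\<lambda>x. x"]
        by (simp add: set_lebesgue_integral_def mult.commute)
    qed
    finally show ?thesis .
  qed
  have clamp_int: "integrable unif clamp01"
    by (rule unif.integrable_const_bound[where B=1]) (auto simp: clamp01_def[abs_def])
  have int2': "AE y in unif. integrable unif (\<lambda>x. d2 C x y)" "integrable unif (\<lambda>y. LINT x|unif. d2 C x y)"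
    using unif2.AE_integrable_snd[OF int2] unif2.integrable_snd[OF int2] by auto
  have "(LINT y|unif. LINT x|unif. (d1 C x y)\<^sup>2 + (d2 C x y)\<^sup>2)
      \<le> (LINT y|unif. clamp01 y + (LINT x|unif. d2 C x y))"
  proof (rule integral_mono_AE[OF integrable_sobolev(2)[OF C]])
    show "integrable unif (\<lambda>y. clamp01 y + (LINT x|unif. d2 C x y))"
      by (intro Bochner_Integration.integrable_add clamp_int int2')
    show "AE y in unif. (LINT x|unif. (d1 C x y)\<^sup>2 + (d2 C x y)\<^sup>2) \<le> clamp01 y + (LINT x|unif. d2 C x y)"
      using integrable_sobolev(1)[OF C] AE_partials_bounds[OF C] int2'(1)
    proof eventually_elim
      case (elim y)
      have "(LINT x|unif. (d1 C x y)\<^sup>2 + (d2 C x y)\<^sup>2) \<le> (LINT x|unif. d1 C x y + d2 C x y)"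
      proof (rule integral_mono_AE[OF elim(1)])
        show "AE x in unif. (d1 C x y)\<^sup>2 + (d2 C x y)\<^sup>2 \<le> d1 C x y + d2 C x y"
          using elim(2) by eventually_elim (auto intro!: add_mono simp: power2_eq_square mult_left_le)
      qed (intro Bochner_Integration.integrable_add integrable_d1 C elim)
      also have "\<dots> = clamp01 y + (LINT x|unif. d2 C x y)"
        by (subst Bochner_Integration.integral_add) (simp_all add: integrable_d1 C elim integral_d1)
      finally show ?case .
    qed
  qed
  also have "\<dots> = 1 / 2 + (LINT x|unif. LINT y|unif. d2 C x y)"
    by (subst Bochner_Integration.integral_add) (simp_all add: clamp_int int2' half swap)
  also have "\<dots> = 1" by (simp add: integral_d2[OF C] half)
  finally show ?thesis unfolding sobolev_norm_eq by simp
qed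

text \<open>Since all Sobolev norms involved are at most $1$, it suffices to come arbitrarily close to $1$.\<close>

lemma star_norm_eq_1I:
  assumes A: "A \<in> copulas"
    and approx: "\<And>e. e > 0 \<Longrightarrow> \<exists>U\<in>inv_copulas. \<exists>V\<in>inv_copulas.
      1 - e \<le> sobolev_norm (star_prod (star_prod U A) V)"
  shows "star_norm A = 1"
proof -
  have le: "sobolev_norm (star_prod (star_prod U A) V) \<le> 1" if "U \<in> inv_copulas" "V \<in> inv_copulas" for U V
    using that A by (intro sobolev_norm_le_1 star_prod_copula) (auto simp: inv_copulas_def)
  have ne: "inv_copulas \<times> inv_copulas \<noteq> {}" using approx[of 1] by auto
  have "star_norm A \<le> 1"
    unfolding star_norm_def using ne by (intro cSUP_least) (auto intro: le)
  moreover have "1 - e \<le> star_norm A" if "e > 0" for e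
  proof -
    obtain U V where UV: "U \<in> inv_copulas" "V \<in> inv_copulas"
      "1 - e \<le> sobolev_norm (star_prod (star_prod U A) V)" using approx[OF \<open>e > 0\<close>] by blast
    note UV(3)
    also have "sobolev_norm (star_prod (star_prod U A) V) \<le> star_norm A"
      unfolding star_norm_def using UV
      by (intro cSUP_upper2[where x="(U, V)"]) (auto intro!: bdd_aboveI2[where M=1] le)
    finally show ?thesis .
  qed
  ultimately show ?thesis by (meson dense_le_bounded field_le_epsilon antisym le_diff_eq diff_le_eq)
qed

section \<open>Copulas of uniform random variables\<close>

definition joint_df :: "'a measure \<Rightarrow> ('a \<Rightarrow> real) \<Rightarrow> ('a \<Rightarrow> real) \<Rightarrow> real \<times> real \<Rightarrow> real" where
  "joint_df P U V = (\<lambda>(u, v)\<in>unit_square. measure P {\<omega> \<in> space P. U \<omega> \<le> u \<and> V \<omega> \<le> v})"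

definition uniform_rv :: "'a measure \<Rightarrow> ('a \<Rightarrow> real) \<Rightarrow> bool" where
  "uniform_rv P U \<longleftrightarrow> U \<in> borel_measurable P \<and>
     (\<forall>u\<in>{0..1}. measure P {\<omega> \<in> space P. U \<omega> \<le> u} = u)"

lemma completely_dependent_trans:
  assumes "completely_dependent P Z Y" "completely_dependent P Y X"
  shows "completely_dependent P Z X"
proof -
  obtain g h where gh: "g \<in> borel_measurable borel" "h \<in> borel_measurable borel"
    "AE \<omega> in P. Z \<omega> = g (Y \<omega>)" "AE \<omega> in P. Y \<omega> = h (X \<omega>)"
    using assms unfolding completely_dependent_def by blast
  have "AE \<omega> in P. Z \<omega> = (\<lambda>x. g (h x)) (X \<omega>)" using gh(3,4) by eventually_elim simp
  moreover have "(\<lambda>x. g (h x)) \<in> borel_measurable borel" using gh(1,2) by measurable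
  ultimately show ?thesis unfolding completely_dependent_def by (intro bexI[of _ "\<lambda>x. g (h x)"])
qed

lemma completely_dependent_function:
  "h \<in> borel_measurable borel \<Longrightarrow> completely_dependent P (\<lambda>\<omega>. h (X \<omega>)) X"
  unfolding completely_dependent_def by auto

lemma flip_joint_df: "flip (joint_df P U V) = joint_df P V U"
  by (auto simp: flip_def joint_df_def fun_eq_iff intro!: arg_cong[where f="measure P"])

context prob_space
begin

lemma uniform_rv_measurable: "uniform_rv M U \<Longrightarrow> U \<in> borel_measurable M"
  by (simp add: uniform_rv_def)

lemma prob_uniform_le:
  assumes U: "uniform_rv M U"
  shows "prob {\<omega> \<in> space M. U \<omega> \<le> u} = clamp01 u"
proof -
  note [measurable] = uniform_rv_measurable[OF U]
  consider "u < 0" | "0 \<le> u" "u \<le> 1" | "1 < u" by linarith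
  then show ?thesis
  proof cases
    case 1
    have "prob {\<omega> \<in> space M. U \<omega> \<le> u} \<le> prob {\<omega> \<in> space M. U \<omega> \<le> 0}"
      using 1 by (intro finite_measure_mono) auto
    also have "\<dots> = 0" using U by (simp add: uniform_rv_def)
    finally show ?thesis using 1 by (simp add: measure_le_0_iff)
  next
    case 2
    then show ?thesis using U by (simp add: uniform_rv_def)
  next
    case 3
    have "prob {\<omega> \<in> space M. U \<omega> \<le> 1} \<le> prob {\<omega> \<in> space M. U \<omega> \<le> u}"
      using 3 by (intro finite_measure_mono) auto
    moreover have "prob {\<omega> \<in> space M. U \<omega> \<le> 1} = 1" using U by (simp add: uniform_rv_def)
    ultimately show ?thesis using 3 prob_le_1[of "{\<omega> \<in> space M. U \<omega> \<le> u}"] by simp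
  qed
qed

lemma distr_uniform:
  assumes U: "uniform_rv M U"
  shows "distr M borel U = distr unif borel (\<lambda>x. x)"
proof (rule cdf_unique)
  note [measurable] = uniform_rv_measurable[OF U]
  show "real_distribution (distr M borel U)" "real_distribution (distr unif borel (\<lambda>x. x))"
    by simp_all
  show "cdf (distr M borel U) = cdf (distr unif borel (\<lambda>x. x))"
  proof
    fix u
    have "cdf (distr M borel U) u = clamp01 u"
      using prob_uniform_le[OF U, of u]
      by (simp add: cdf_def measure_distr vimage_def Collect_conj_eq Int_commute)
    moreover have "cdf (distr unif borel (\<lambda>x. x)) u = clamp01 u"
    proof -
      have "cdf (distr unif borel (\<lambda>x. x)) u = measure lborel ({0<..<1} \<inter> {..u})"
        by (simp add: cdf_def measure_distr measure_restrict_space Int_commute)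
      also have "\<dots> = clamp01 u"
      proof -
        consider "u < 0" | "0 \<le> u" "u < 1" | "1 \<le> u" by linarith
        then show ?thesis
        proof cases
          case 1
          then have "{0<..<1} \<inter> {..u} = {}" by auto
          then show ?thesis using 1 by simp
        next
          case 2
          then have "{0<..<1} \<inter> {..u} = {0<..u}" by auto
          then show ?thesis using 2 by simp
        next
          case 3
          then have "{0<..<1} \<inter> {..u} = {0<..<1}" by auto
          then show ?thesis using 3 by simp
        qed
      qed
      finally show ?thesis .
    qed
    ultimately show "cdf (distr M borel U) u = cdf (distr unif borel (\<lambda>x. x)) u" by simp
  qed
qed

lemma prob_uniform:
  assumes U: "uniform_rv M U" and [measurable]: "B \<in> sets borel"
  shows "prob {\<omega> \<in> space M. U \<omega> \<in> B} = (LINT t|unif. indicator B t)"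
proof -
  note [measurable] = uniform_rv_measurable[OF U]
  have "prob {\<omega> \<in> space M. U \<omega> \<in> B} = measure (distr M borel U) B"
    by (simp add: measure_distr vimage_def Collect_conj_eq Int_commute)
  also have "\<dots> = measure (distr unif borel (\<lambda>x. x)) B" by (simp only: distr_uniform[OF U])
  also have "\<dots> = (LINT t|distr unif borel (\<lambda>x. x). indicator B t)" by simp
  also have "\<dots> = (LINT t|unif. indicator B t)"
    by (rule integral_distr) simp_all
  finally show ?thesis .
qed

lemma AE_uniform_bounds:
  assumes U: "uniform_rv M U"
  shows "AE \<omega> in M. 0 < U \<omega> \<and> U \<omega> < 1"
proof -
  note [measurable] = uniform_rv_measurable[OF U]
  have "prob {\<omega> \<in> space M. U \<omega> \<in> {0<..<1}} = (LINT t|unif. indicator {0<..<1} t)"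
    by (rule prob_uniform[OF U]) simp
  also have "\<dots> = (LINT t|unif. 1)"
    by (intro Bochner_Integration.integral_cong) auto
  also have "\<dots> = 1" by (simp add: unif.prob_space[simplified])
  finally show ?thesis
    by (subst (asm) prob_Collect_eq_1) auto
qed

lemma prob_joint_eq_expectation:
  assumes [measurable]: "U \<in> borel_measurable M" "V \<in> borel_measurable M"
  shows "prob {\<omega> \<in> space M. U \<omega> \<le> u \<and> V \<omega> \<le> v} =
    expectation (\<lambda>\<omega>. indicator {..u} (U \<omega>) * indicator {..v} (V \<omega>))"
proof -
  have "prob {\<omega> \<in> space M. U \<omega> \<le> u \<and> V \<omega> \<le> v} =
      expectation (indicator {\<omega> \<in> space M. U \<omega> \<le> u \<and> V \<omega> \<le> v})"
    by (simp add: Int_absorb2 Collect_subset)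
  also have "\<dots> = expectation (\<lambda>\<omega>. indicator {..u} (U \<omega>) * indicator {..v} (V \<omega>))"
    by (intro Bochner_Integration.integral_cong) (auto split: split_indicator)
  finally show ?thesis .
qed

text \<open>The mass of a rectangle is the expectation of a product of two indicators, hence nonnegative.\<close>

lemma joint_df_copula:
  assumes U: "uniform_rv M U" and V: "uniform_rv M V"
  shows "joint_df M U V \<in> copulas"
proof -
  note [measurable] = uniform_rv_measurable[OF U] uniform_rv_measurable[OF V]
  let ?H = "\<lambda>u v. prob {\<omega> \<in> space M. U \<omega> \<le> u \<and> V \<omega> \<le> v}"
  have "?H u 0 = 0 \<and> ?H 0 u = 0 \<and> ?H u 1 = u \<and> ?H 1 u = u" if "u \<in> {0..1}" for u
  proof -
    have "AE \<omega> in M. \<not> (U \<omega> \<le> u \<and> V \<omega> \<le> 0)" "AE \<omega> in M. \<not> (U \<omega> \<le> 0 \<and> V \<omega> \<le> u)"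
      using AE_uniform_bounds[OF U] AE_uniform_bounds[OF V] by (eventually_elim, auto)+
    then have "?H u 0 = 0" "?H 0 u = 0"
      by (subst prob_Collect_eq_0; simp)+
    moreover have "?H u 1 = prob {\<omega> \<in> space M. U \<omega> \<le> u}"
      by (intro finite_measure_eq_AE, use AE_uniform_bounds[OF V] in eventually_elim) auto
    moreover have "?H 1 u = prob {\<omega> \<in> space M. V \<omega> \<le> u}"
      by (intro finite_measure_eq_AE, use AE_uniform_bounds[OF U] in eventually_elim) auto
    ultimately show ?thesis using that by (simp add: prob_uniform_le U V)
  qed
  moreover have "?H u v - ?H u y - ?H x v + ?H x y \<ge> 0" if "x \<le> u" "y \<le> v" for x u y v
  proof -
    let ?i = "\<lambda>u v \<omega>. indicator {..u} (U \<omega>) * indicator {..v} (V \<omega>) :: real"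
    have int: "integrable M (?i u v)" for u v
      by (rule integrable_const_bound[where B=1]) (auto simp: indicator_def)
    have "0 \<le> expectation (\<lambda>\<omega>. (indicator {..u} (U \<omega>) - indicator {..x} (U \<omega>)) *
        (indicator {..v} (V \<omega>) - indicator {..y} (V \<omega>)) :: real)"
      by (intro integral_nonneg_AE AE_I2) (use that in \<open>auto simp: indicator_def\<close>)
    also have "\<dots> = expectation (\<lambda>\<omega>. (?i u v \<omega> - ?i u y \<omega>) - (?i x v \<omega> - ?i x y \<omega>))"
      by (simp add: algebra_simps)
    also have "\<dots> = (?H u v - ?H u y) - (?H x v - ?H x y)"
      by (simp add: int prob_joint_eq_expectation)
    finally show ?thesis by simp
  qed
  ultimately show ?thesis
    unfolding copulas_def by (auto simp: joint_df_def PiE_iff)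
qed

lemma extend_joint_df:
  assumes U: "uniform_rv M U" and V: "uniform_rv M V" and "0 \<le> v" "v \<le> 1"
  shows "extend (joint_df M U V) u v = prob {\<omega> \<in> space M. U \<omega> \<le> u \<and> V \<omega> \<le> v}"
proof -
  note [measurable] = uniform_rv_measurable[OF U] uniform_rv_measurable[OF V]
  have "extend (joint_df M U V) u v = prob {\<omega> \<in> space M. U \<omega> \<le> clamp01 u \<and> V \<omega> \<le> v}"
    using assms by (simp add: extend_def joint_df_def)
  also have "\<dots> = prob {\<omega> \<in> space M. U \<omega> \<le> u \<and> V \<omega> \<le> v}"
    by (intro finite_measure_eq_AE, use AE_uniform_bounds[OF U] in eventually_elim)
      (auto simp: clamp01_def)
  finally show ?thesis .
qed

text \<open>If the event $V \<le> v$ is determined by $U$, then $C_{U,V}(s,v)$ is the Lebesgue measure of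
$B \<inter> (0,s]$, so its derivative is the conditional probability of that event given $U$, which is
an indicator.\<close>

lemma d1_joint_df:
  assumes U: "uniform_rv M U" and V: "uniform_rv M V" and v: "0 \<le> v" "v \<le> 1"
    and B [measurable]: "B \<in> sets borel" and VB: "AE \<omega> in M. V \<omega> \<le> v \<longleftrightarrow> U \<omega> \<in> B"
  shows "AE t in unif. d1 (joint_df M U V) t v = indicator B t"
proof -
  note [measurable] = uniform_rv_measurable[OF U] uniform_rv_measurable[OF V]
  let ?F = "\<lambda>s. extend (joint_df M U V) s v"
  define g :: "real \<Rightarrow> real" where "g = indicator (B \<inter> {0<..<1})"
  have g: "integrable lborel g"
    unfolding g_def
  proof (rule integrable_real_indicator)
    have "emeasure lborel (B \<inter> {0<..<1}) \<le> emeasure lborel {0<..<1::real}"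
      by (rule emeasure_mono) auto
    also have "\<dots> < \<infinity>" by simp
    finally show "emeasure lborel (B \<inter> {0<..<1}) < \<infinity>" .
  qed simp
  have F: "?F s = (LINT t|unif. indicator ({..s} \<inter> B) t)" for s
  proof -
    have "?F s = prob {\<omega> \<in> space M. U \<omega> \<le> s \<and> V \<omega> \<le> v}" by (rule extend_joint_df[OF U V v])
    also have "\<dots> = prob {\<omega> \<in> space M. U \<omega> \<in> {..s} \<inter> B}"
      by (intro finite_measure_eq_AE, use VB in eventually_elim) auto
    also have "\<dots> = (LINT t|unif. indicator ({..s} \<inter> B) t)" by (rule prob_uniform[OF U]) simp
    finally show ?thesis .
  qed
  have "?F b - ?F a = (LBINT t:{a..b}. g t)" if "a \<le> b" for a b
  proof -
    have int: "integrable unif (indicator ({..s} \<inter> B) :: real \<Rightarrow> real)" for s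
      by (rule unif.integrable_const_bound[where B=1]) (auto simp: indicator_def intro!: measurable_unif)
    have "?F b - ?F a = (LINT t|unif. indicator ({..b} \<inter> B) t - indicator ({..a} \<inter> B) t)"
      by (simp only: F Bochner_Integration.integral_diff[OF int int])
    also have "\<dots> = (LINT t|unif. indicator ({a<..b} \<inter> B) t)"
      using that by (intro Bochner_Integration.integral_cong) (auto split: split_indicator)
    also have "\<dots> = (LBINT t:{a<..b}. g t)"
      by (subst integral_restrict_space)
        (auto simp: set_lebesgue_integral_def g_def indicator_inter_arith intro!: Bochner_Integration.integral_cong split: split_indicator)
    also have "\<dots> = (LBINT t:{a..b}. g t)"
      by (rule set_integral_discrete_difference[where X="{a}"]) auto
    finally show ?thesis .
  qed
  from lebesgue_differentiation[OF g this]
  have "AE t in lborel. (?F has_real_derivative g t) (at t)" .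
  then show ?thesis
    unfolding AE_unif
    by eventually_elim (auto simp: d1_def g_def DERIV_imp_deriv indicator_def)
qed

lemma AE_completely_dependent_le:
  assumes "completely_dependent M V U"
  obtains B where "B \<in> sets borel" "AE \<omega> in M. V \<omega> \<le> v \<longleftrightarrow> U \<omega> \<in> B"
proof -
  obtain h where [measurable]: "h \<in> borel_measurable borel" and h: "AE \<omega> in M. V \<omega> = h (U \<omega>)"
    using assms unfolding completely_dependent_def by blast
  show thesis
  proof (rule that[of "{t. h t \<le> v}"])
    show "AE \<omega> in M. V \<omega> \<le> v \<longleftrightarrow> U \<omega> \<in> {t. h t \<le> v}" using h by eventually_elim simp
  qed measurable
qed

text \<open>In general the star product describes $Z$ and $V$ as conditionally independent given $U$, which
is automatic when both are functions of $U$.\<close>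

theorem star_prod_joint_df:
  assumes Z: "uniform_rv M Z" and U: "uniform_rv M U" and V: "uniform_rv M V"
    and ZU: "completely_dependent M Z U" and VU: "completely_dependent M V U"
  shows "star_prod (joint_df M Z U) (joint_df M U V) = joint_df M Z V"
proof (rule copula_eqI)
  show "star_prod (joint_df M Z U) (joint_df M U V) \<in> copulas"
    by (intro star_prod_copula joint_df_copula Z U V)
  show "joint_df M Z V \<in> copulas" by (intro joint_df_copula Z V)
  note [measurable] = uniform_rv_measurable[OF Z] uniform_rv_measurable[OF U] uniform_rv_measurable[OF V]
  fix z v :: real assume zv: "0 \<le> z" "z \<le> 1" "0 \<le> v" "v \<le> 1"
  obtain A where A [measurable]: "A \<in> sets borel" and ZA: "AE \<omega> in M. Z \<omega> \<le> z \<longleftrightarrow> U \<omega> \<in> A"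
    by (rule AE_completely_dependent_le[OF ZU])
  obtain B where B [measurable]: "B \<in> sets borel" and VB: "AE \<omega> in M. V \<omega> \<le> v \<longleftrightarrow> U \<omega> \<in> B"
    by (rule AE_completely_dependent_le[OF VU])
  have "star_prod (joint_df M Z U) (joint_df M U V) (z, v)
      = (LINT t|unif. d1 (joint_df M U Z) t z * d1 (joint_df M U V) t v)"
    using zv by (simp add: star_prod_eq d1_flip[symmetric] flip_joint_df)
  also have "\<dots> = (LINT t|unif. indicator (A \<inter> B) t)"
  proof (rule integral_cong_AE)
    show "AE t in unif. d1 (joint_df M U Z) t z * d1 (joint_df M U V) t v = indicator (A \<inter> B) t"
      using d1_joint_df[OF U Z zv(1,2) A ZA] d1_joint_df[OF U V zv(3,4) B VB]
      by eventually_elim (simp add: indicator_inter_arith)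
  qed (intro borel_measurable_times measurable_d1 joint_df_copula U Z V measurable_unif; simp)+
  also have "\<dots> = prob {\<omega> \<in> space M. U \<omega> \<in> A \<inter> B}" by (rule prob_uniform[OF U, symmetric]) simp
  also have "\<dots> = prob {\<omega> \<in> space M. Z \<omega> \<le> z \<and> V \<omega> \<le> v}"
    by (intro finite_measure_eq_AE, use ZA VB in eventually_elim) auto
  also have "\<dots> = joint_df M Z V (z, v)" using zv by (simp add: joint_df_def)
  finally show "star_prod (joint_df M Z U) (joint_df M U V) (z, v) = joint_df M Z V (z, v)" .
qed

lemma joint_df_self:
  assumes "uniform_rv M U"
  shows "joint_df M U U = M_copula"
proof (rule copula_eqI)
  fix u v :: real assume "0 \<le> u" "u \<le> 1" "0 \<le> v" "v \<le> 1"
  moreover have "{\<omega> \<in> space M. U \<omega> \<le> u \<and> U \<omega> \<le> v} = {\<omega> \<in> space M. U \<omega> \<le> min u v}" by auto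
  ultimately show "joint_df M U U (u, v) = M_copula (u, v)"
    using prob_uniform_le[OF assms, of "min u v"] by (simp add: joint_df_def M_copula_def)
qed (simp_all add: joint_df_copula assms M_copula)

lemma joint_df_invertible:
  assumes Z: "uniform_rv M Z" and U: "uniform_rv M U"
    and "completely_dependent M Z U" "completely_dependent M U Z"
  shows "joint_df M Z U \<in> inv_copulas"
  unfolding inv_copulas_def using assms
  by (auto intro!: bexI[of _ "joint_df M U Z"] joint_df_copula simp: star_prod_joint_df joint_df_self)

text \<open>If $U \<le> s$ forces $V \<le> y$, then $C_{U,V}(s,y)$ is just $P(U \<le> s) = s$.\<close>

lemma d1_joint_df_far:
  assumes U: "uniform_rv M U" and V: "uniform_rv M V"
    and close: "AE \<omega> in M. \<bar>U \<omega> - V \<omega>\<bar> \<le> d" and x: "0 < x" "x < y - d" "y \<le> 1" "0 \<le> d"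
  shows "d1 (joint_df M U V) x y = 1"
proof -
  note [measurable] = uniform_rv_measurable[OF U] uniform_rv_measurable[OF V]
  have "\<forall>\<^sub>F s in nhds x. s \<in> {0<..<y - d}" using x by (intro eventually_nhds_in_open) auto
  then have "\<forall>\<^sub>F s in nhds x. extend (joint_df M U V) s y = s"
  proof eventually_elim
    case (elim s)
    have "extend (joint_df M U V) s y = prob {\<omega> \<in> space M. U \<omega> \<le> s \<and> V \<omega> \<le> y}"
      using x by (intro extend_joint_df U V) auto
    also have "\<dots> = prob {\<omega> \<in> space M. U \<omega> \<le> s}"
      by (intro finite_measure_eq_AE, use close in eventually_elim) (use elim in auto)
    also have "\<dots> = s" using elim x by (simp add: prob_uniform_le[OF U])
    finally show ?case .
  qed
  then have "d1 (joint_df M U V) x y = deriv (\<lambda>s. s) x" unfolding d1_def by (rule deriv_cong_ev) simp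
  then show ?thesis by simp
qed

text \<open>At every point of the square whose coordinates differ by more than $d$, one of the two partial
derivatives is $1$, and the exceptional strip $|x - y| \<le> d$ meets each horizontal line in length at
most $2d$. The squared norm is thus at least $1 - 2d$, and a number in the unit interval is at
least its square.\<close>

lemma sobolev_norm_near_diagonal:
  assumes Z: "uniform_rv M Z" and V: "uniform_rv M V"
    and close: "AE \<omega> in M. \<bar>Z \<omega> - V \<omega>\<bar> \<le> d" and d: "0 \<le> d"
  shows "1 - 2 * d \<le> sobolev_norm (joint_df M Z V)"
proof -
  let ?C = "joint_df M Z V"
  let ?S = "LINT y|unif. LINT x|unif. (d1 ?C x y)\<^sup>2 + (d2 ?C x y)\<^sup>2"
  have C: "?C \<in> copulas" by (rule joint_df_copula[OF Z V])
  have close': "AE \<omega> in M. \<bar>V \<omega> - Z \<omega>\<bar> \<le> d"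
    using close by eventually_elim (simp add: abs_minus_commute)
  have "(LINT y|unif. 1 - 2 * d) \<le> ?S"
  proof (rule integral_mono_AE[OF _ integrable_sobolev(2)[OF C]])
    show "AE y in unif. 1 - 2 * d \<le> (LINT x|unif. (d1 ?C x y)\<^sup>2 + (d2 ?C x y)\<^sup>2)"
      using integrable_sobolev(1)[OF C] AE_space
    proof eventually_elim
      case (elim y)
      then have y: "0 < y" "y < 1" by auto
      have ind: "integrable unif (indicator {y - d..y + d} :: real \<Rightarrow> real)"
        by (rule unif.integrable_const_bound[where B=1]) (auto simp: indicator_def intro!: measurable_unif)
      have "(LINT x|unif. indicator {y - d..y + d} x) = measure lborel ({y - d..y + d} \<inter> {0<..<1})"
        by (simp add: measure_restrict_space)
      also have "\<dots> \<le> measure lborel {y - d..y + d}"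
        by (rule measure_mono_fmeasurable) (use d in \<open>auto simp: fmeasurable_def\<close>)
      also have "\<dots> = 2 * d" using d by simp
      finally have "1 - 2 * d \<le> (LINT x|unif. 1) - (LINT x|unif. indicator {y - d..y + d} x)"
        by (simp add: unif.prob_space[simplified])
      also have "\<dots> = (LINT x|unif. 1 - indicator {y - d..y + d} x)"
        by (rule Bochner_Integration.integral_diff[symmetric]) (auto intro: ind)
      also have "\<dots> \<le> (LINT x|unif. (d1 ?C x y)\<^sup>2 + (d2 ?C x y)\<^sup>2)"
      proof (rule integral_mono)
        fix x assume "x \<in> space unif"
        then have x: "0 < x" "x < 1" by auto
        show "1 - indicator {y - d..y + d} x \<le> (d1 ?C x y)\<^sup>2 + (d2 ?C x y)\<^sup>2"
        proof -
          consider "x < y - d" | "y < x - d" | "x \<in> {y - d..y + d}" by fastforce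
          then show ?thesis
          proof cases
            case 1
            then have "d1 ?C x y = 1" using x y d by (intro d1_joint_df_far[OF Z V close]) auto
            then show ?thesis using d 1 by (auto simp: indicator_def)
          next
            case 2
            then have "d1 (joint_df M V Z) y x = 1"
              using x y d by (intro d1_joint_df_far[OF V Z close']) auto
            then have "d2 ?C x y = 1" by (simp add: d1_flip[symmetric] flip_joint_df)
            then show ?thesis using d 2 by (auto simp: indicator_def)
          qed simp
        qed
      qed (auto intro: ind elim)
      finally show ?case .
    qed
  qed simp
  then have S: "1 - 2 * d \<le> ?S" by (simp add: unif.prob_space[simplified])
  have n: "sobolev_norm ?C = sqrt ?S" by (rule sobolev_norm_eq)
  have "0 \<le> ?S" by (intro integral_nonneg_AE AE_I2) auto
  then have "?S = sobolev_norm ?C * sobolev_norm ?C" by (simp add: n)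
  also have "\<dots> \<le> sobolev_norm ?C"
    using sobolev_norm_le_1[OF C] \<open>0 \<le> ?S\<close> by (intro mult_left_le) (simp_all add: n)
  finally have "?S \<le> sqrt ?S" by (simp only: n)
  then show ?thesis using S n by simp
qed

end

section \<open>The probability integral transform\<close>

context prob_space
begin

abbreviation cdf_transform :: "('a \<Rightarrow> real) \<Rightarrow> 'a \<Rightarrow> real" where
  "cdf_transform X \<equiv> (\<lambda>\<omega>. cdf (distr M borel X) (X \<omega>))"

lemma cdf_distr_eq:
  "X \<in> borel_measurable M \<Longrightarrow> cdf (distr M borel X) x = prob {\<omega> \<in> space M. X \<omega> \<le> x}"
  by (simp add: cdf_def measure_distr vimage_def Collect_conj_eq Int_commute)

context
  fixes X assumes X: "continuous_rv M X"
begin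

interpretation D: cdf_distribution "distr M borel X"
  unfolding cdf_distribution_def using X by (simp add: continuous_rv_def real_distribution_distr)

lemma continuous_rv_measurable: "X \<in> borel_measurable M"
  using X by (simp add: continuous_rv_def)

lemma measurable_cdf_transform: "cdf_transform X \<in> borel_measurable M"
  by (rule measurable_compose[OF continuous_rv_measurable D.measurable_C])

lemma cdf_surj:
  assumes "0 < u" "u < 1"
  obtains x where "cdf (distr M borel X) x = u"
proof -
  have "\<forall>\<^sub>F x in at_bot. D.C x < u" using assms(1) by (rule order_tendstoD(2)[OF D.bot])
  then obtain a where a: "D.C a < u" using eventually_happens'[OF trivial_limit_at_bot_linorder] by blast
  have "\<forall>\<^sub>F x in at_top. u < D.C x" using assms(2) by (rule order_tendstoD(1)[OF D.top])
  then obtain b where b: "u < D.C b" using eventually_happens'[OF trivial_limit_at_top_linorder] by blast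
  have "a \<le> b" using a b D.mono by (meson less_le_not_le linear monoD order_trans)
  moreover have "continuous_on {a..b} D.C"
    using X by (auto simp: continuous_rv_def intro: continuous_on_subset)
  ultimately show thesis using IVT'[of D.C a u b] a b that by auto
qed

text \<open>By continuity every level in $(0,1)$ is a value of $F$. If $F(x) = u < w = F(x')$, then the event
$F(X) \<le> u$ contains $X \<le> x$ and is contained in $X \<le> x'$, so its probability lies between $u$ and
every such $w$.\<close>

lemma uniform_cdf_transform: "uniform_rv M (cdf_transform X)"
proof -
  note [measurable] = continuous_rv_measurable measurable_cdf_transform
  have le: "prob {\<omega> \<in> space M. D.C (X \<omega>) \<le> u} \<le> w" if "u < w" "0 < w" "w < 1" for u w
  proof -
    obtain x where x: "D.C x = w" using cdf_surj \<open>0 < w\<close> \<open>w < 1\<close> by blast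
    have "{\<omega> \<in> space M. D.C (X \<omega>) \<le> u} \<subseteq> {\<omega> \<in> space M. X \<omega> \<le> x}"
    proof clarsimp
      fix \<omega> assume "D.C (X \<omega>) \<le> u"
      then have "\<not> D.C x \<le> D.C (X \<omega>)" using x \<open>u < w\<close> by simp
      then show "X \<omega> \<le> x" using monoD[OF D.mono, of x "X \<omega>"] by (meson linear)
    qed
    then have "prob {\<omega> \<in> space M. D.C (X \<omega>) \<le> u} \<le> prob {\<omega> \<in> space M. X \<omega> \<le> x}"
      by (intro finite_measure_mono) auto
    then show ?thesis using x by (simp add: cdf_distr_eq continuous_rv_measurable)
  qed
  have "prob {\<omega> \<in> space M. D.C (X \<omega>) \<le> u} = u" if u: "0 \<le> u" "u \<le> 1" for u
  proof (rule antisym)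
    show "prob {\<omega> \<in> space M. D.C (X \<omega>) \<le> u} \<le> u"
    proof (cases "u = 1")
      case False
      show ?thesis
        by (rule dense_ge_bounded[of u 1]) (use u False le in auto)
    qed simp
    show "u \<le> prob {\<omega> \<in> space M. D.C (X \<omega>) \<le> u}"
    proof -
      consider "u = 0" | "u = 1" | "0 < u" "u < 1" using u by linarith
      then show ?thesis
      proof cases
        case 2
        then show ?thesis using D.cdf_bounded_prob by (simp add: prob_space)
      next
        case 3
        then obtain x where x: "D.C x = u" using cdf_surj by blast
        have "{\<omega> \<in> space M. X \<omega> \<le> x} \<subseteq> {\<omega> \<in> space M. D.C (X \<omega>) \<le> u}"
          using x D.mono by (auto dest: monoD)
        then have "prob {\<omega> \<in> space M. X \<omega> \<le> x} \<le> prob {\<omega> \<in> space M. D.C (X \<omega>) \<le> u}"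
          by (intro finite_measure_mono) auto
        then show ?thesis using x by (simp add: cdf_distr_eq continuous_rv_measurable)
      qed simp
    qed
  qed
  then show ?thesis by (simp add: uniform_rv_def measurable_cdf_transform)
qed

text \<open>One event contains the other by monotonicity of $F$, and both have probability $F(x)$.\<close>

lemma AE_cdf_transform_le_iff: "AE \<omega> in M. D.C (X \<omega>) \<le> D.C x \<longleftrightarrow> X \<omega> \<le> x"
proof -
  note [measurable] = continuous_rv_measurable measurable_cdf_transform
  have sub: "{\<omega> \<in> space M. X \<omega> \<le> x} \<subseteq> {\<omega> \<in> space M. D.C (X \<omega>) \<le> D.C x}"
    using D.mono by (auto dest: monoD)
  have "prob {\<omega> \<in> space M. D.C (X \<omega>) \<le> D.C x} = clamp01 (D.C x)"
    by (rule prob_uniform_le[OF uniform_cdf_transform])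
  also have "\<dots> = prob {\<omega> \<in> space M. X \<omega> \<le> x}"
    using D.cdf_nonneg[of x] D.cdf_bounded_prob[of x] by (simp add: cdf_distr_eq continuous_rv_measurable)
  finally have "prob ({\<omega> \<in> space M. D.C (X \<omega>) \<le> D.C x} - {\<omega> \<in> space M. X \<omega> \<le> x}) = 0"
    by (subst finite_measure_Diff[OF _ _ sub]) auto
  then have "prob {\<omega> \<in> space M. D.C (X \<omega>) \<le> D.C x \<and> \<not> X \<omega> \<le> x} = 0"
    by (simp add: set_diff_eq conj_commute conj_left_commute cong: conj_cong)
  then have "AE \<omega> in M. \<not> (D.C (X \<omega>) \<le> D.C x \<and> \<not> X \<omega> \<le> x)"
    by (subst (asm) prob_Collect_eq_0) auto
  then show ?thesis by eventually_elim (use D.mono in \<open>auto dest: monoD\<close>)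
qed

text \<open>The quantile function recovers $X$ from $F(X)$ almost surely: $F(X)$ determines, up to null sets,
all the events $X \<le> r$ with $r$ rational.\<close>

lemma completely_dependent_cdf_transform: "completely_dependent M X (cdf_transform X)"
proof -
  \<comment> \<open>The quantile function is only meaningful on \<open>(0, 1)\<close>, where \<open>F(X)\<close> takes its values almost surely.\<close>
  define h where "h u = D.I u * indicator {0<..<1} u" for u
  have h: "h \<in> borel_measurable borel"
    using D.measurable_CI unfolding h_def
    by (subst (asm) borel_measurable_restrict_space_iff) (auto simp: mult.commute)
  have "AE \<omega> in M. \<forall>r\<in>\<rat>. D.C (X \<omega>) \<le> D.C r \<longleftrightarrow> X \<omega> \<le> r"
    by (subst AE_ball_countable[OF countable_rat]) (use AE_cdf_transform_le_iff in blast)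
  then have "AE \<omega> in M. X \<omega> = h (D.C (X \<omega>))"
    using AE_uniform_bounds[OF uniform_cdf_transform]
  proof eventually_elim
    case (elim \<omega>)
    have ps: "D.C (X \<omega>) \<le> D.C x \<longleftrightarrow> D.I (D.C (X \<omega>)) \<le> x" for x
      using elim(2) by (intro D.pseudoinverse) auto
    have "D.I (D.C (X \<omega>)) = X \<omega>"
    proof (rule antisym)
      show "D.I (D.C (X \<omega>)) \<le> X \<omega>" using ps[of "X \<omega>"] by simp
      show "X \<omega> \<le> D.I (D.C (X \<omega>))"
      proof (rule ccontr)
        assume "\<not> ?thesis"
        then obtain r where r: "r \<in> \<rat>" "D.I (D.C (X \<omega>)) < r" "r < X \<omega>"
          using Rats_dense_in_real[of "D.I (D.C (X \<omega>))" "X \<omega>"] by auto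
        then show False using ps[of r] elim(1) by auto
      qed
    qed
    then show ?case using elim(2) by (simp add: h_def)
  qed
  then show ?thesis using h unfolding completely_dependent_def by blast
qed

lemma cdf_transform_completely_dependent: "completely_dependent M (cdf_transform X) X"
  by (rule completely_dependent_function[OF D.measurable_C])

end

text \<open>Both sides agree on $F(\mathbb{R}) \<times> G(\mathbb{R})$, which contains the open square by
continuity of the distribution functions; on the boundary of the square all copulas coincide.\<close>

lemma copula_of_eq_joint_df:
  assumes X: "continuous_rv M X" and Y: "continuous_rv M Y"
  shows "copula_of M X Y = joint_df M (cdf_transform X) (cdf_transform Y)"
proof -
  let ?F = "cdf (distr M borel X)" and ?G = "cdf (distr M borel Y)"
  let ?J = "joint_df M (cdf_transform X) (cdf_transform Y)"
  note [measurable] = continuous_rv_measurable[OF X] continuous_rv_measurable[OF Y]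
    measurable_cdf_transform[OF X] measurable_cdf_transform[OF Y]
  have J: "?J \<in> copulas" by (intro joint_df_copula uniform_cdf_transform X Y)
  have bnd: "0 \<le> ?F x" "?F x \<le> 1" "0 \<le> ?G x" "?G x \<le> 1" for x
    by (simp_all add: cdf_distr_eq)
  have Sklar: "prob {\<omega> \<in> space M. X \<omega> \<le> x \<and> Y \<omega> \<le> y} = ?J (?F x, ?G y)" for x y
  proof -
    have "?J (?F x, ?G y) = prob {\<omega> \<in> space M. ?F (X \<omega>) \<le> ?F x \<and> ?G (Y \<omega>) \<le> ?G y}"
      using bnd by (simp add: joint_df_def)
    also have "\<dots> = prob {\<omega> \<in> space M. X \<omega> \<le> x \<and> Y \<omega> \<le> y}"
      by (intro finite_measure_eq_AE,
          use AE_cdf_transform_le_iff[OF X, of x] AE_cdf_transform_le_iff[OF Y, of y] in eventually_elim) auto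
    finally show ?thesis by simp
  qed
  show ?thesis
    unfolding copula_of_def
  proof (rule the_equality)
    show "?J \<in> copulas \<and> (\<forall>x y. prob {\<omega> \<in> space M. X \<omega> \<le> x \<and> Y \<omega> \<le> y} = ?J (?F x, ?G y))"
      using J Sklar by simp
    fix D assume D: "D \<in> copulas \<and> (\<forall>x y. prob {\<omega> \<in> space M. X \<omega> \<le> x \<and> Y \<omega> \<le> y} = D (?F x, ?G y))"
    show "D = ?J"
    proof (rule copula_eqI)
      fix u v :: real assume uv: "0 \<le> u" "u \<le> 1" "0 \<le> v" "v \<le> 1"
      show "D (u, v) = ?J (u, v)"
      proof (cases "0 < u \<and> u < 1 \<and> 0 < v \<and> v < 1")
        case True
        then obtain x y where "?F x = u" "?G y = v" using cdf_surj[OF X] cdf_surj[OF Y] by metis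
        then show ?thesis using D Sklar by metis
      next
        case False
        then have "u = 0 \<or> u = 1 \<or> v = 0 \<or> v = 1" using uv by auto
        then show ?thesis using uv D J by (auto simp: copulas_def)
      qed
    qed (use D J in auto)
  qed
qed

section \<open>Rearranging one variable along the other\<close>

text \<open>The random variable $Z$ is $F_K(K)$ for the key $K = \<lfloor>nV\<rfloor> + U$, which orders first by the
$n$-th part of the unit interval that contains $V$ and then by $U$. With $k = \<lfloor>nV\<rfloor>$, the values below
the current key all have $V \<le> (k+1)/n$ and include those with $V < k/n$, whence
$k/n \<le> Z \<le> (k+1)/n$. The key has no atoms because its fractional part is the uniform variable $U$.\<close>

lemma rearrangement_near_diagonal:
  assumes U: "uniform_rv M U" and V: "uniform_rv M V"
    and VU: "completely_dependent M V U" and n: "0 < (n::nat)"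
  obtains Z where "uniform_rv M Z" "completely_dependent M Z U" "completely_dependent M U Z"
    "AE \<omega> in M. \<bar>Z \<omega> - V \<omega>\<bar> \<le> 1 / real n"
proof -
  note [measurable] = uniform_rv_measurable[OF U] uniform_rv_measurable[OF V]
  define K where "K \<omega> = of_int \<lfloor>real n * V \<omega>\<rfloor> + U \<omega>" for \<omega>
  have K [measurable]: "K \<in> borel_measurable M" unfolding K_def by measurable
  have KU: "completely_dependent M K U"
  proof -
    obtain h where [measurable]: "h \<in> borel_measurable borel" and h: "AE \<omega> in M. V \<omega> = h (U \<omega>)"
      using VU unfolding completely_dependent_def by blast
    show ?thesis unfolding completely_dependent_def
    proof (rule bexI[of _ "\<lambda>u. of_int \<lfloor>real n * h u\<rfloor> + u"])
      show "AE \<omega> in M. K \<omega> = of_int \<lfloor>real n * h (U \<omega>)\<rfloor> + U \<omega>"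
        using h by eventually_elim (simp add: K_def)
    qed measurable
  qed
  have UK: "AE \<omega> in M. U \<omega> = frac (K \<omega>)"
    using AE_uniform_bounds[OF U]
  proof eventually_elim
    case (elim \<omega>)
    then show ?case by (simp add: K_def frac_def) linarith
  qed
  have UK': "completely_dependent M U K"
    unfolding completely_dependent_def using UK by (intro bexI[of _ frac]) (auto simp: frac_def[abs_def])
  have Kc: "continuous_rv M K"
  proof -
    interpret D: real_distribution "distr M borel K" by simp
    have "isCont (cdf (distr M borel K)) k" for k
    proof -
      have "measure (distr M borel K) {k} = prob {\<omega> \<in> space M. K \<omega> = k}"
        by (simp add: measure_distr vimage_def Collect_conj_eq Int_commute)
      also have "\<dots> \<le> prob {\<omega> \<in> space M. U \<omega> \<in> {frac k}}"
        by (intro finite_measure_mono_AE, use UK in eventually_elim) auto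
      also have "\<dots> = (LINT t|unif. indicator {frac k} t)" by (rule prob_uniform[OF U]) simp
      also have "\<dots> = (LINT t|unif. 0)"
      proof (rule integral_cong_AE)
        show "AE t in unif. indicator {frac k} t = (0::real)"
          using AE_unif_neq[of "frac k"] by eventually_elim simp
      qed (auto intro: measurable_unif)
      finally have "measure (distr M borel K) {k} = 0" by (simp add: measure_le_0_iff)
      then show ?thesis by (simp add: D.isCont_cdf)
    qed
    then show ?thesis by (simp add: continuous_rv_def continuous_on_eq_continuous_at)
  qed
  define Z where "Z = cdf_transform K"
  have Z: "uniform_rv M Z" unfolding Z_def by (rule uniform_cdf_transform[OF Kc])
  have ZU: "completely_dependent M Z U" unfolding Z_def
    by (rule completely_dependent_trans[OF cdf_transform_completely_dependent[OF Kc] KU])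
  have UZ: "completely_dependent M U Z" unfolding Z_def
    by (rule completely_dependent_trans[OF UK' completely_dependent_cdf_transform[OF Kc]])
  have "AE \<omega> in M. \<bar>Z \<omega> - V \<omega>\<bar> \<le> 1 / real n"
    using AE_uniform_bounds[OF U] AE_uniform_bounds[OF V] AE_space
  proof eventually_elim
    case (elim \<omega>)
    define k where "k = \<lfloor>real n * V \<omega>\<rfloor>"
    have k: "of_int k \<le> real n * V \<omega>" "real n * V \<omega> < of_int k + 1" unfolding k_def by linarith+
    have Zw: "Z \<omega> = prob {\<omega>' \<in> space M. K \<omega>' \<le> K \<omega>}" by (simp add: Z_def cdf_distr_eq)
    have k0: "0 \<le> k" unfolding k_def using elim n by simp
    have "Z \<omega> \<le> prob {\<omega>' \<in> space M. V \<omega>' \<le> (of_int k + 1) / real n}"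
      unfolding Zw
    proof (rule finite_measure_mono_AE)
      show "AE \<omega>' in M. \<omega>' \<in> {\<omega>' \<in> space M. K \<omega>' \<le> K \<omega>} \<longrightarrow>
          \<omega>' \<in> {\<omega>' \<in> space M. V \<omega>' \<le> (of_int k + 1) / real n}"
        using AE_uniform_bounds[OF U]
      proof eventually_elim
        case (elim \<omega>')
        have "V \<omega>' \<le> (of_int k + 1) / real n" if "K \<omega>' \<le> K \<omega>"
        proof -
          have "of_int \<lfloor>real n * V \<omega>'\<rfloor> < (of_int k + 1 :: real)"
            using that elim \<open>0 < U \<omega> \<and> U \<omega> < 1\<close> by (simp add: K_def k_def)
          then have "\<lfloor>real n * V \<omega>'\<rfloor> \<le> k" by linarith
          then have "real n * V \<omega>' < of_int k + 1" by linarith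
          then show ?thesis using n by (simp add: field_simps)
        qed
        then show ?case by auto
      qed
    qed simp
    also have "\<dots> \<le> (of_int k + 1) / real n"
      unfolding prob_uniform_le[OF V] using k0 by (auto simp: clamp01_def)
    also have "\<dots> \<le> V \<omega> + 1 / real n" using k n by (simp add: field_simps)
    finally have up: "Z \<omega> \<le> V \<omega> + 1 / real n" .
    have "of_int k / real n \<le> prob {\<omega>' \<in> space M. V \<omega>' \<in> {..<of_int k / real n}}"
    proof -
      have "of_int k / real n \<le> 1"
      proof -
        have "real n * V \<omega> \<le> real n" using elim n by simp
        then have "of_int k \<le> real n" using k(1) by (rule order_trans[rotated])
        then show ?thesis using n by simp
      qed
      then have "of_int k / real n = clamp01 (of_int k / real n)" using k0 by simp
      also have "\<dots> = prob {\<omega>' \<in> space M. V \<omega>' \<in> {..of_int k / real n}}"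
        using prob_uniform_le[OF V] by simp
      also have "\<dots> = prob {\<omega>' \<in> space M. V \<omega>' \<in> {..<of_int k / real n}}"
        unfolding prob_uniform[OF V lessThan_borel] prob_uniform[OF V atMost_borel]
      proof (rule integral_cong_AE)
        show "AE t in unif. indicator {..of_int k / real n} t = (indicator {..<of_int k / real n} t :: real)"
          using AE_unif_neq[of "of_int k / real n"] by eventually_elim (auto simp: indicator_def)
      qed (auto intro: measurable_unif)
      finally show ?thesis by simp
    qed
    also have "\<dots> \<le> Z \<omega>"
      unfolding Zw
    proof (rule finite_measure_mono_AE)
      show "AE \<omega>' in M. \<omega>' \<in> {\<omega>' \<in> space M. V \<omega>' \<in> {..<of_int k / real n}} \<longrightarrow>
          \<omega>' \<in> {\<omega>' \<in> space M. K \<omega>' \<le> K \<omega>}"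
        using AE_uniform_bounds[OF U]
      proof eventually_elim
        case (elim \<omega>')
        have "K \<omega>' \<le> K \<omega>" if "V \<omega>' < of_int k / real n"
        proof -
          have "real n * V \<omega>' < of_int k" using that n by (simp add: field_simps)
          then have "\<lfloor>real n * V \<omega>'\<rfloor> \<le> k - 1" by linarith
          then have "of_int \<lfloor>real n * V \<omega>'\<rfloor> \<le> (of_int k - 1 :: real)" by linarith
          then show ?thesis using elim \<open>0 < U \<omega> \<and> U \<omega> < 1\<close> by (simp add: K_def k_def)
        qed
        then show ?case by auto
      qed
    qed simp
    finally have "of_int k / real n \<le> Z \<omega>" .
    moreover have "V \<omega> \<le> (of_int k + 1) / real n"
      using k n by (simp add: pos_le_divide_eq mult.commute)
    ultimately show ?case using up by (simp add: add_divide_distrib)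
  qed
  with Z ZU UZ show thesis by (rule that)
qed

lemma M_copula_invertible: "M_copula \<in> inv_copulas"
  unfolding inv_copulas_def using M_copula star_prod_M_left[OF M_copula] by blast

text \<open>The factor on the side that needs no rearrangement is the identity $M$ of the star product.\<close>

theorem star_norm_joint_df:
  assumes U: "uniform_rv M U" and V: "uniform_rv M V"
    and dep: "completely_dependent M V U \<or> completely_dependent M U V"
  shows "star_norm (joint_df M U V) = 1"
proof (rule star_norm_eq_1I)
  show J: "joint_df M U V \<in> copulas" by (rule joint_df_copula[OF U V])
  fix e :: real assume "0 < e"
  obtain n :: nat where n: "0 < n" "1 / real n < e / 2"
    using \<open>0 < e\<close> by (metis half_gt_zero nat_approx_posE of_nat_0_less_iff zero_less_Suc)
  from dep show "\<exists>A\<in>inv_copulas. \<exists>B\<in>inv_copulas.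
      1 - e \<le> sobolev_norm (star_prod (star_prod A (joint_df M U V)) B)"
  proof
    assume VU: "completely_dependent M V U"
    obtain Z where Z: "uniform_rv M Z" "completely_dependent M Z U" "completely_dependent M U Z"
      "AE \<omega> in M. \<bar>Z \<omega> - V \<omega>\<bar> \<le> 1 / real n"
      by (rule rearrangement_near_diagonal[OF U V VU n(1)])
    have "star_prod (star_prod (joint_df M Z U) (joint_df M U V)) M_copula = joint_df M Z V"
      by (simp add: star_prod_joint_df Z U V VU star_prod_M_right joint_df_copula)
    moreover have "1 - 2 * (1 / real n) \<le> sobolev_norm (joint_df M Z V)"
      by (rule sobolev_norm_near_diagonal[OF Z(1) V Z(4)]) simp
    ultimately show ?thesis
      using n by (intro bexI[of _ "joint_df M Z U"] bexI[of _ M_copula])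
        (simp_all add: joint_df_invertible Z U M_copula_invertible)
  next
    assume UV: "completely_dependent M U V"
    obtain Z where Z: "uniform_rv M Z" "completely_dependent M Z V" "completely_dependent M V Z"
      "AE \<omega> in M. \<bar>Z \<omega> - U \<omega>\<bar> \<le> 1 / real n"
      by (rule rearrangement_near_diagonal[OF V U UV n(1)])
    have close: "AE \<omega> in M. \<bar>U \<omega> - Z \<omega>\<bar> \<le> 1 / real n"
      using Z(4) by eventually_elim (simp add: abs_minus_commute)
    have "star_prod (star_prod M_copula (joint_df M U V)) (joint_df M V Z) = joint_df M U Z"
      by (simp add: star_prod_joint_df Z U V UV star_prod_M_left joint_df_copula)
    moreover have "1 - 2 * (1 / real n) \<le> sobolev_norm (joint_df M U Z)"
      by (rule sobolev_norm_near_diagonal[OF U Z(1) close]) simp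
    ultimately show ?thesis
      using n by (intro bexI[of _ M_copula] bexI[of _ "joint_df M V Z"])
        (simp_all add: joint_df_invertible Z V M_copula_invertible)
  qed
qed

end

theorem theorem5p4:
  fixes P :: "'a measure" and X Y :: "'a \<Rightarrow> real"
  assumes "prob_space P"
    and "continuous_rv P X" and "continuous_rv P Y"
    and "completely_dependent P Y X \<or> completely_dependent P X Y"
  shows "star_norm (copula_of P X Y) = 1"
proof -
  interpret prob_space P by fact
  have lift: "completely_dependent P (cdf_transform W) (cdf_transform W')"
    if "continuous_rv P W" "continuous_rv P W'" "completely_dependent P W W'" for W W'
    using completely_dependent_trans[OF cdf_transform_completely_dependent[OF that(1)]
        completely_dependent_trans[OF that(3) completely_dependent_cdf_transform[OF that(2)]]] .
  show ?thesis
    unfolding copula_of_eq_joint_df[OF assms(2,3)]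
    using assms(4) lift[OF assms(3,2)] lift[OF assms(2,3)]
    by (intro star_norm_joint_df uniform_cdf_transform assms) blast
qed

end
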